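(* Let $\Omega$ be a bounded connected open subset of $\mathbb{R}^n$ with $C^2$ boundary, let $0<T_1<T<\infty$, $\lambda,\Lambda>0$ and $r>0$. There exist constants $\epsilon,\mu>0$, depending only on $n,\lambda,\Lambda,\Omega,r,T_1,T$, such that the following holds. Let $B\subset\Omega$ be a ball of radius $r$, let $a_{ij},b_i,c\in L^\infty(\Omega\times(0,T])$ satisfy $$|a_{ij}(x,t)|+|b_i(x,t)|+|c(x,t)|\le\Lambda,\qquad a_{ij}(x,t)\xi_i\xi_j\ge\lambda|\xi|^2\qquad\text{for all }x\in\Omega,\ 0<t\le T,\ \xi\in\mathbb{R}^n,$$ and set $Lu:=a_{ij}(x,t)\partial_{ij}u+b_i(x,t)\partial_iu+c(x,t)u$. If $u\in LSC(\overline\Omega\times[0,T])$ satisfies $$(L-\partial_t)u\le\epsilon\quad\text{in }\Omega\times(0,T]\text{ in the viscosity sense},$$ $$u(x,0)\ge1\quad\text{for all }x\in B,$$ $$u\ge0\quad\text{on }P\partial(\Omega\times(0,T]),$$ then $$u(x,t)\ge\mu\,\mathrm{dist}(x,\partial\Omega)\quad\text{on }\Omega\times[T_1,T].$$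
   Context: $LSC$ denotes lower-semicontinuous functions; repeated indices are summed; $\partial_i,\partial_{ij}$ are derivatives in $x$. The parabolic boundary is $P\partial(\Omega\times(0,T])=(\overline\Omega\times\{0\})\cup(\partial\Omega\times[0,T])$. The coefficients are bounded measurable functions defined at every point. Viscosity sense: whenever $(x_0,t_0)\in\Omega\times(0,T]$ and $\varphi$ is a $C^2$ function near $(x_0,t_0)$ with $\varphi\le u$ at the points of $\Omega\times(0,T]$ near $(x_0,t_0)$ and $\varphi(x_0,t_0)=u(x_0,t_0)$, one has $(L\varphi-\varphi_t)(x_0,t_0)\le\epsilon$. *)

theory Defs
  imports "HOL-Analysis.Analysis"
begin

definition C2_on :: "'a::euclidean_space set \<Rightarrow> ('a \<Rightarrow> real) \<Rightarrow> bool" where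
  "C2_on S f \<longleftrightarrow> open S \<and>
     (\<exists>(f' :: 'a \<Rightarrow> 'a \<Rightarrow>\<^sub>L real) (f'' :: 'a \<Rightarrow> 'a \<Rightarrow>\<^sub>L ('a \<Rightarrow>\<^sub>L real)).
        (\<forall>x\<in>S. (f has_derivative blinfun_apply (f' x)) (at x) \<and>
               (f' has_derivative blinfun_apply (f'' x)) (at x)) \<and>
        continuous_on S f'')"

text \<open>Near each boundary point, \<open>\<Omega>\<close> is the region on one side of the graph of a \<open>C\<^sup>2\<close> function,
  in some direction \<open>\<nu>\<close>. The graph function lives on the hyperplane orthogonal to \<open>\<nu>\<close>; it is
  represented by a function \<open>g\<close> on the whole space that does not depend on the \<open>\<nu>\<close> coordinate,
  which avoids a change of dimension.\<close>

definition C2_boundary :: "'a::euclidean_space set \<Rightarrow> bool" where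
  "C2_boundary \<Omega> \<longleftrightarrow>
     (\<forall>p\<in>frontier \<Omega>. \<exists>\<rho>>0. \<exists>\<nu> g.
        norm \<nu> = 1 \<and> C2_on UNIV g \<and> (\<forall>x s. g (x + s *\<^sub>R \<nu>) = g x) \<and>
        \<Omega> \<inter> ball p \<rho> = {x \<in> ball p \<rho>. g x < x \<bullet> \<nu>})"

definition lsc_on :: "'a::topological_space set \<Rightarrow> ('a \<Rightarrow> real) \<Rightarrow> bool" where
  "lsc_on S u \<longleftrightarrow> (\<forall>p\<in>S. \<forall>s<u p. \<forall>\<^sub>F q in at p within S. s < u q)"

text \<open>Space-time points are pairs \<open>(x, t)\<close>; the following are partial derivatives in \<open>x\<close> and \<open>t\<close>.\<close>

definition dx :: "'n \<Rightarrow> ((real^'n) \<times> real \<Rightarrow> real) \<Rightarrow> (real^'n) \<times> real \<Rightarrow> real" where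
  "dx i \<phi> p = deriv (\<lambda>s. \<phi> (fst p + s *\<^sub>R axis i 1, snd p)) 0"

definition dt :: "((real^'n) \<times> real \<Rightarrow> real) \<Rightarrow> (real^'n) \<times> real \<Rightarrow> real" where
  "dt \<phi> p = deriv (\<lambda>s. \<phi> (fst p, s)) (snd p)"

definition L_op ::
  "('n::finite \<Rightarrow> 'n \<Rightarrow> (real^'n) \<times> real \<Rightarrow> real) \<Rightarrow> ('n \<Rightarrow> (real^'n) \<times> real \<Rightarrow> real) \<Rightarrow>
   ((real^'n) \<times> real \<Rightarrow> real) \<Rightarrow> ((real^'n) \<times> real \<Rightarrow> real) \<Rightarrow> (real^'n) \<times> real \<Rightarrow> real" where
  "L_op a b c \<phi> p =
     (\<Sum>i\<in>UNIV. \<Sum>j\<in>UNIV. a i j p * dx i (dx j \<phi>) p) + (\<Sum>i\<in>UNIV. b i p * dx i \<phi> p) + c p * \<phi> p"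

definition coeff_conds ::
  "(real^'n) set \<Rightarrow> real \<Rightarrow> real \<Rightarrow> real \<Rightarrow> ('n::finite \<Rightarrow> 'n \<Rightarrow> (real^'n) \<times> real \<Rightarrow> real) \<Rightarrow>
   ('n \<Rightarrow> (real^'n) \<times> real \<Rightarrow> real) \<Rightarrow> ((real^'n) \<times> real \<Rightarrow> real) \<Rightarrow> bool" where
  "coeff_conds \<Omega> T lam Lam a b c \<longleftrightarrow>
     (\<forall>i j. a i j \<in> borel_measurable (lebesgue_on (\<Omega> \<times> {0<..T}))) \<and>
     (\<forall>i. b i \<in> borel_measurable (lebesgue_on (\<Omega> \<times> {0<..T}))) \<and>
     c \<in> borel_measurable (lebesgue_on (\<Omega> \<times> {0<..T})) \<and>
     (\<forall>p \<in> \<Omega> \<times> {0<..T}.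
        (\<forall>i j. \<bar>a i j p\<bar> + \<bar>b i p\<bar> + \<bar>c p\<bar> \<le> Lam) \<and>
        (\<forall>\<xi>::real^'n. (\<Sum>i\<in>UNIV. \<Sum>j\<in>UNIV. a i j p * \<xi>$i * \<xi>$j) \<ge> lam * (norm \<xi>)\<^sup>2))"

text \<open>\<open>(L - \<partial>\<^sub>t) u \<le> \<epsilon>\<close> in the viscosity sense. The test function is \<open>C\<^sup>2\<close> on a full neighbourhood
  \<open>U\<close> of the contact point, also when the contact time is \<open>T\<close>, but lies below \<open>u\<close> only on
  \<open>\<Omega> \<times> (0, T]\<close>.\<close>

definition viscosity_le ::
  "(real^'n) set \<Rightarrow> real \<Rightarrow> ('n::finite \<Rightarrow> 'n \<Rightarrow> (real^'n) \<times> real \<Rightarrow> real) \<Rightarrow>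
   ('n \<Rightarrow> (real^'n) \<times> real \<Rightarrow> real) \<Rightarrow> ((real^'n) \<times> real \<Rightarrow> real) \<Rightarrow>
   ((real^'n) \<times> real \<Rightarrow> real) \<Rightarrow> real \<Rightarrow> bool" where
  "viscosity_le \<Omega> T a b c u \<epsilon> \<longleftrightarrow>
     (\<forall>p \<in> \<Omega> \<times> {0<..T}. \<forall>\<phi> U.
        p \<in> U \<and> C2_on U \<phi> \<and> (\<forall>q \<in> U \<inter> (\<Omega> \<times> {0<..T}). \<phi> q \<le> u q) \<and> \<phi> p = u p
        \<longrightarrow> L_op a b c \<phi> p - dt \<phi> p \<le> \<epsilon>)"

definition parabolic_boundary :: "(real^'n) set \<Rightarrow> real \<Rightarrow> ((real^'n) \<times> real) set" where
  "parabolic_boundary \<Omega> T = closure \<Omega> \<times> {0} \<union> frontier \<Omega> \<times> {0..T}"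

end

theory Submission
  imports Defs
begin

text \<open>The solution \<open>u\<close> is compared from below with explicit classical subsolutions. A subsolution
  that exceeds \<open>u\<close> somewhere can be pushed down by a multiple of \<open>e\<^bsup>\<Lambda>t\<^esup>\<close> until it touches \<open>u\<close>
  from below, and at the contact point the definition of a viscosity supersolution applies with the
  pushed-down function as test function; the exponential factor absorbs the zeroth order
  coefficient, whose sign is arbitrary. This is \<open>comparison_principle\<close>. It is formulated
  for subsets of space-time that are open relative to \<open>\<Omega> \<times> (0, T]\<close>, since the
  barriers live on different domains.

  Since \<open>(L - \<partial>\<^sub>t) u \<le> \<epsilon>\<close> only, \<open>u\<close> may become slightly negative, but not below
  \<open>- 2 \<epsilon> e\<^bsup>(\<Lambda> + 1) t\<^esup>\<close> (\<open>supersolution_lower_bound\<close>). Positivity then spreads in two ways.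

  Inside \<open>\<Omega>\<close>, the barrier is a decaying multiple of the cube of the positive part of
  \<open>m(t) - |x - z|\<^sup>2\<close>, where the radius \<open>\<surd>m(t)\<close> grows from \<open>s\<close> towards \<open>R\<close> (\<open>expanding_barrier\<close>).
  Near the edge of its support the second order term
  dominates by ellipticity, and away from the edge the decay rate dominates, so this is a
  subsolution. Cubing makes it globally \<open>C\<^sup>2\<close>, and therefore one comparison on all of \<open>\<Omega>\<close> suffices. As a
  consequence a lower bound on a small ball is carried, within any prescribed time, to the
  concentric ball of radius \<open>R/2\<close> whenever that of radius \<open>R\<close> lies in \<open>\<Omega>\<close>
  (\<open>expansion_of_positivity\<close>). Since \<open>\<Omega>\<close> is connected, the set of
  points near which \<open>u\<close> has a uniform positive lower bound after every positive time is all of \<open>\<Omega>\<close>,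
  and compactness makes the bound uniform on compact sets and in the initial ball
  (\<open>interior_positivity\<close>).

  Near a boundary point let \<open>h(x) = x \<bullet> \<nu> - g(x)\<close> be the height above the graph describing
  \<open>\<partial>\<Omega>\<close>. The gradient of \<open>h\<close> has length at least 1, so for \<open>M\<close> much larger than \<open>N\<close> the function
  \<open>h + M h\<^sup>2 - N |(x, t) - (z, t\<^sub>0)|\<^sup>2\<close> is a strict subsolution in the strip \<open>0 < h < 1/M\<close>
  near a boundary point \<open>z\<close>. It is at most \<open>0\<close> on \<open>\<partial>\<Omega>\<close>, at most \<open>-1\<close> at a fixed distance from
  \<open>(z, t\<^sub>0)\<close>, and the remaining part of the boundary of this region lies in the interior of \<open>\<Omega>\<close>, where
  \<open>u\<close> is already known to be positive (\<open>boundary_barrier\<close>). At the point of height \<open>h\<close> above \<open>z\<close> the barrier is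
  at least \<open>h\<close>, which is at least the distance to \<open>\<partial>\<Omega>\<close> (\<open>boundary_growth\<close>). A finite cover of the closure of \<open>\<Omega>\<close> finishes
  the proof.

  All quantitative statements use one constant \<open>e\<close> both as the bound on \<open>(L - \<partial>\<^sub>t) u\<close> and as the
  constant in the lower bound for \<open>u\<close>. Such statements are preserved when \<open>e\<close> decreases, so
  finitely many of them hold with a common constant.\<close>

section \<open>Functions with continuous second derivatives\<close>

text \<open>The second derivative is kept as a real function \<open>H p h v\<close> of two directions instead of a bounded
  linear map into bounded linear maps, so that sums, products and compositions can be
  differentiated with the usual rules, and the operator can be read off from \<open>D\<close> and \<open>H\<close>.\<close>

definition C2_jets ::
  "('a::euclidean_space \<Rightarrow> real) \<Rightarrow> ('a \<Rightarrow> 'a \<Rightarrow> real) \<Rightarrow> ('a \<Rightarrow> 'a \<Rightarrow> 'a \<Rightarrow> real) \<Rightarrow> bool" where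
  "C2_jets f D H \<longleftrightarrow>
     (\<forall>p. (f has_derivative D p) (at p)) \<and>
     (\<forall>p v. ((\<lambda>q. D q v) has_derivative (\<lambda>h. H p h v)) (at p)) \<and>
     (\<forall>h v. continuous_on UNIV (\<lambda>p. H p h v))"

lemma C2_jets_has_derivative: "C2_jets f D H \<Longrightarrow> (f has_derivative D p) (at p)"
  and C2_jets_has_derivative2: "C2_jets f D H \<Longrightarrow> ((\<lambda>q. D q v) has_derivative (\<lambda>h. H p h v)) (at p)"
  and C2_jets_continuous2: "C2_jets f D H \<Longrightarrow> continuous_on UNIV (\<lambda>p. H p h v)"
  by (auto simp: C2_jets_def)

lemma C2_jets_continuous: "C2_jets f D H \<Longrightarrow> continuous_on UNIV f"
  by (meson C2_jets_has_derivative continuous_at_imp_continuous_on has_derivative_continuous)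

lemma C2_jets_continuous1: "C2_jets f D H \<Longrightarrow> continuous_on UNIV (\<lambda>p. D p v)"
  by (intro continuous_at_imp_continuous_on ballI) (rule has_derivative_continuous[OF C2_jets_has_derivative2])

text \<open>In finite dimension the directional data determine the operators: \<open>D p\<close> and \<open>H p\<close> are expanded in the
  basis, so that continuity of each entry gives continuity in the operator norm.\<close>

lemma C2_jets_imp_C2_on:
  fixes f :: "'a::euclidean_space \<Rightarrow> real"
  assumes J: "C2_jets f D H" and S: "open S"
  shows "C2_on S f"
proof -
  define f' where "f' q = (\<Sum>i\<in>Basis. D q i *\<^sub>R (blinfun_inner_left i :: 'a \<Rightarrow>\<^sub>L real))" for q
  define f'' :: "'a \<Rightarrow> 'a \<Rightarrow>\<^sub>L 'a \<Rightarrow>\<^sub>L real" where "f'' q = (\<Sum>j\<in>Basis. \<Sum>i\<in>Basis. H q j i *\<^sub>R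
      (blinfun_scaleR_left (blinfun_inner_left i :: 'a \<Rightarrow>\<^sub>L real) o\<^sub>L (blinfun_inner_left j :: 'a \<Rightarrow>\<^sub>L real)))" for q
  have lin_D: "linear (D q)" for q
    using C2_jets_has_derivative[OF J] has_derivative_linear by blast
  have lin_H: "linear (\<lambda>h. H q h v)" for q v
    using C2_jets_has_derivative2[OF J] has_derivative_linear by blast
  have f'_apply: "blinfun_apply (f' q) = D q" for q
  proof
    fix v
    have "D q v = D q (\<Sum>i\<in>Basis. (v \<bullet> i) *\<^sub>R i)" by (simp add: euclidean_representation)
    also have "\<dots> = (\<Sum>i\<in>Basis. (v \<bullet> i) *\<^sub>R D q i)"
      by (simp add: linear_sum[OF lin_D] linear_scale[OF lin_D])
    finally show "f' q v = D q v"
      by (simp add: f'_def blinfun.bilinear_simps inner_commute mult.commute blinfun.sum_left)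
  qed
  have f''_apply: "f'' q h = (\<Sum>i\<in>Basis. H q h i *\<^sub>R (blinfun_inner_left i :: 'a \<Rightarrow>\<^sub>L real))" for q h
  proof -
    have *: "H q h i = (\<Sum>j\<in>Basis. (h \<bullet> j) * H q j i)" for i
    proof -
      have "H q h i = H q (\<Sum>j\<in>Basis. (h \<bullet> j) *\<^sub>R j) i" by (simp add: euclidean_representation)
      then show ?thesis
        by (simp add: linear_sum[OF lin_H] linear_scale[OF lin_H])
    qed
    have "f'' q h = (\<Sum>j\<in>Basis. \<Sum>i\<in>Basis. ((h \<bullet> j) * H q j i) *\<^sub>R (blinfun_inner_left i :: 'a \<Rightarrow>\<^sub>L real))"
      unfolding f''_def by (simp add: blinfun.sum_left blinfun.scaleR_left inner_commute mult.commute)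
    also have "\<dots> = (\<Sum>i\<in>Basis. (\<Sum>j\<in>Basis. (h \<bullet> j) * H q j i) *\<^sub>R (blinfun_inner_left i :: 'a \<Rightarrow>\<^sub>L real))"
      by (subst sum.swap) (simp add: scaleR_sum_left)
    finally show ?thesis unfolding *[symmetric] .
  qed
  have "(f has_derivative blinfun_apply (f' x)) (at x)" for x
    using C2_jets_has_derivative[OF J] f'_apply by simp
  moreover have "(f' has_derivative blinfun_apply (f'' x)) (at x)" for x
    unfolding f'_def[abs_def] f''_apply[abs_def]
    by (intro has_derivative_sum has_derivative_scaleR_left C2_jets_has_derivative2[OF J])
  moreover have "continuous_on S f''"
    unfolding f''_def[abs_def]
    by (intro continuous_intros continuous_on_subset[OF C2_jets_continuous2[OF J]]) auto
  ultimately show ?thesis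
    using S unfolding C2_on_def by blast
qed

lemma C2_on_UNIV_imp_C2_jets:
  assumes "C2_on UNIV f"
  obtains D H where "C2_jets f D H"
proof -
  obtain f' :: "'a \<Rightarrow> 'a \<Rightarrow>\<^sub>L real" and f'' :: "'a \<Rightarrow> 'a \<Rightarrow>\<^sub>L ('a \<Rightarrow>\<^sub>L real)"
    where 1: "\<And>x. (f has_derivative blinfun_apply (f' x)) (at x)"
      and 2: "\<And>x. (f' has_derivative blinfun_apply (f'' x)) (at x)"
      and 3: "continuous_on UNIV f''"
    using assms unfolding C2_on_def by auto
  have "C2_jets f (\<lambda>x. blinfun_apply (f' x)) (\<lambda>x h. blinfun_apply (f'' x h))"
    unfolding C2_jets_def
  proof (intro conjI allI)
    fix p v
    show "((\<lambda>q. f' q v) has_derivative (\<lambda>h. f'' p h v)) (at p)"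
      by (rule bounded_linear.has_derivative[OF blinfun.bounded_linear_left 2])
  qed (auto intro!: 1 continuous_intros 3)
  then show ?thesis ..
qed

lemma C2_jets_const: "C2_jets (\<lambda>_. k) (\<lambda>_ _. 0) (\<lambda>_ _ _. 0)"
  by (simp add: C2_jets_def)

lemma C2_jets_linear: "bounded_linear l \<Longrightarrow> C2_jets l (\<lambda>_. l) (\<lambda>_ _ _. 0)"
  by (simp add: C2_jets_def bounded_linear_imp_has_derivative)

lemma C2_jets_add:
  "C2_jets f D H \<Longrightarrow> C2_jets g E I \<Longrightarrow>
   C2_jets (\<lambda>p. f p + g p) (\<lambda>p v. D p v + E p v) (\<lambda>p h v. H p h v + I p h v)"
  unfolding C2_jets_def by (auto intro!: derivative_intros continuous_intros)

lemma C2_jets_cmult: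
  "C2_jets f D H \<Longrightarrow> C2_jets (\<lambda>p. k * f p) (\<lambda>p v. k * D p v) (\<lambda>p h v. k * H p h v)"
  unfolding C2_jets_def by (auto intro!: derivative_intros continuous_intros)

lemma C2_jets_mult:
  assumes f: "C2_jets f D H" and g: "C2_jets g E I"
  shows "C2_jets (\<lambda>p. f p * g p) (\<lambda>p v. f p * E p v + D p v * g p)
     (\<lambda>p h v. f p * I p h v + D p h * E p v + (D p v * E p h + H p h v * g p))"
  unfolding C2_jets_def
  by (intro conjI allI)
    (rule derivative_eq_intros C2_jets_has_derivative[OF f] C2_jets_has_derivative[OF g]
      C2_jets_has_derivative2[OF f] C2_jets_has_derivative2[OF g] refl |
     intro continuous_intros C2_jets_continuous[OF f] C2_jets_continuous[OF g]
      C2_jets_continuous1[OF f] C2_jets_continuous1[OF g]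
      C2_jets_continuous2[OF f] C2_jets_continuous2[OF g] | simp)+

lemma C2_jets_compose:
  assumes f: "C2_jets f D H"
    and \<psi>: "\<And>z. (\<psi> has_real_derivative \<psi>' z) (at z)"
    and \<psi>': "\<And>z. (\<psi>' has_real_derivative \<psi>'' z) (at z)"
    and \<psi>'': "continuous_on UNIV \<psi>''"
  shows "C2_jets (\<lambda>p. \<psi> (f p)) (\<lambda>p v. \<psi>' (f p) * D p v)
     (\<lambda>p h v. \<psi>' (f p) * H p h v + \<psi>'' (f p) * D p h * D p v)"
proof -
  have 1: "((\<lambda>p. \<psi> (f p)) has_derivative (\<lambda>v. \<psi>' (f p) * D p v)) (at p)" for p
    using has_derivative_compose[OF C2_jets_has_derivative[OF f] \<psi>[THEN has_field_derivative_imp_has_derivative]] .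
  have 2: "((\<lambda>p. \<psi>' (f p)) has_derivative (\<lambda>v. \<psi>'' (f p) * D p v)) (at p)" for p
    using has_derivative_compose[OF C2_jets_has_derivative[OF f] \<psi>'[THEN has_field_derivative_imp_has_derivative]] .
  have c': "continuous_on UNIV \<psi>'"
    by (meson DERIV_continuous \<psi>' continuous_at_imp_continuous_on)
  note cf = C2_jets_continuous[OF f]
  show ?thesis
    unfolding C2_jets_def
  proof (intro conjI allI 1)
    show "((\<lambda>q. \<psi>' (f q) * D q v) has_derivative
           (\<lambda>h. \<psi>' (f p) * H p h v + \<psi>'' (f p) * D p h * D p v)) (at p)" for p v
      using has_derivative_mult[OF 2 C2_jets_has_derivative2[OF f]] .
    show "continuous_on UNIV (\<lambda>p. \<psi>' (f p) * H p h v + \<psi>'' (f p) * D p h * D p v)" for h v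
      by (intro continuous_intros C2_jets_continuous1[OF f] C2_jets_continuous2[OF f]
          continuous_on_compose2[OF c' cf] continuous_on_compose2[OF \<psi>'' cf]) auto
  qed
qed

lemma C2_jets_fst:
  assumes f: "C2_jets f D H"
  shows "C2_jets (\<lambda>p::'a::euclidean_space \<times> 'b::euclidean_space. f (fst p)) (\<lambda>p v. D (fst p) (fst v))
    (\<lambda>p h v. H (fst p) (fst h) (fst v))"
proof -
  have fst': "(fst has_derivative fst) (at p)" for p :: "'a \<times> 'b"
    by (rule derivative_eq_intros | simp)+
  show ?thesis
    unfolding C2_jets_def
  proof (intro conjI allI)
    show "((\<lambda>p::'a \<times> 'b. f (fst p)) has_derivative (\<lambda>v. D (fst p) (fst v))) (at p)" for p
      by (rule has_derivative_compose[OF fst' C2_jets_has_derivative[OF f]])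
    show "((\<lambda>q::'a \<times> 'b. D (fst q) (fst v)) has_derivative (\<lambda>h. H (fst p) (fst h) (fst v))) (at p)" for p v
      by (rule has_derivative_compose[OF fst' C2_jets_has_derivative2[OF f]])
    show "continuous_on UNIV (\<lambda>p. H (fst p) (fst h) (fst v))" for h v :: "'a \<times> 'b"
      by (rule continuous_on_compose2[OF C2_jets_continuous2[OF f]]) (auto intro: continuous_intros)
  qed
qed

lemma C2_jets_norm_square:
  "C2_jets (\<lambda>x. (norm (x - z))\<^sup>2) (\<lambda>x v. 2 * ((x - z) \<bullet> v)) (\<lambda>_ h v. 2 * (h \<bullet> v))"
  unfolding C2_jets_def power2_norm_eq_inner
  by (auto intro!: derivative_eq_intros continuous_intros ext simp: inner_commute)

section \<open>The parabolic operator on explicit functions\<close>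

text \<open>The value of \<open>L \<phi> - \<phi>\<^sub>t\<close> at a point, as a function of the coefficients, of \<open>\<phi>\<close> and of its first and
  second derivatives there.\<close>

definition parabolic_value ::
  "('n::finite \<Rightarrow> 'n \<Rightarrow> real) \<Rightarrow> ('n \<Rightarrow> real) \<Rightarrow> real \<Rightarrow> real \<Rightarrow>
   ((real^'n) \<times> real \<Rightarrow> real) \<Rightarrow> ((real^'n) \<times> real \<Rightarrow> (real^'n) \<times> real \<Rightarrow> real) \<Rightarrow> real" where
  "parabolic_value a b c z D H =
     (\<Sum>i\<in>UNIV. \<Sum>j\<in>UNIV. a i j * H (axis i 1, 0) (axis j 1, 0)) +
     (\<Sum>i\<in>UNIV. b i * D (axis i 1, 0)) + c * z - D (0, 1)"

lemma L_op_eq_parabolic_value: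
  fixes \<phi> :: "(real^'n) \<times> real \<Rightarrow> real"
  assumes J: "C2_jets \<phi> D H"
  shows "L_op a b c \<phi> p - dt \<phi> p =
    parabolic_value (\<lambda>i j. a i j p) (\<lambda>i. b i p) (c p) (\<phi> p) (D p) (H p)"
proof -
  have gen: "dx i f q = F (axis i 1, 0)" if "(f has_derivative F) (at q)"
    for i and f F :: "(real^'n) \<times> real \<Rightarrow> real" and q
  proof -
    have "((\<lambda>s. (fst q + s *\<^sub>R axis i 1, snd q)) has_derivative (\<lambda>s. (s *\<^sub>R axis i 1, 0))) (at 0)"
      by (auto intro!: derivative_eq_intros)
    from has_derivative_compose[OF this, of f F] that
    have "((\<lambda>s. f (fst q + s *\<^sub>R axis i 1, snd q)) has_derivative (\<lambda>s. F (s *\<^sub>R axis i 1, 0))) (at 0)"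
      by simp
    moreover have "(\<lambda>s. F (s *\<^sub>R axis i 1, 0)) = (*) (F (axis i 1, 0))"
      using linear_scale[OF has_derivative_linear[OF that], of _ "(axis i 1, 0)"] by (auto simp: fun_eq_iff)
    ultimately have "((\<lambda>s. f (fst q + s *\<^sub>R axis i 1, snd q)) has_real_derivative F (axis i 1, 0)) (at 0)"
      by (simp add: has_field_derivative_def )
    then show ?thesis unfolding dx_def by (rule DERIV_imp_deriv)
  qed
  have d1: "dx i \<phi> = (\<lambda>q. D q (axis i 1, 0))" for i
    using gen[OF C2_jets_has_derivative[OF J]] by blast
  have d2: "dx i (dx j \<phi>) p = H p (axis i 1, 0) (axis j 1, 0)" for i j
    unfolding d1 using gen[OF C2_jets_has_derivative2[OF J]] by blast
  have "((\<lambda>s. (fst p, s)) has_derivative (\<lambda>s. (0, s))) (at (snd p))"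
    by (auto intro!: derivative_eq_intros)
  from has_derivative_compose[OF this, of \<phi> "D p"] C2_jets_has_derivative[OF J, of p]
  have "((\<lambda>s. \<phi> (fst p, s)) has_derivative (\<lambda>s. D p (0, s))) (at (snd p))"
    by simp
  moreover have "(\<lambda>s. D p (0, s)) = (*) (D p (0, 1))"
  proof (rule ext)
    show "D p (0, s) = D p (0, 1) * s" for s
      using linear_scale[OF has_derivative_linear[OF C2_jets_has_derivative[OF J, of p]], of s "(0, 1)"] by simp
  qed
  ultimately have "((\<lambda>s. \<phi> (fst p, s)) has_real_derivative D p (0, 1)) (at (snd p))"
    by (simp add: has_field_derivative_def )
  then have "dt \<phi> p = D p (0, 1)" unfolding dt_def by (rule DERIV_imp_deriv)
  then show ?thesis
    unfolding L_op_def parabolic_value_def d2 by (simp add: d1)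
qed

lemma parabolic_value_add:
  "parabolic_value a b c (y + z) (\<lambda>v. D v + E v) (\<lambda>h v. H h v + I h v) =
   parabolic_value a b c y D H + parabolic_value a b c z E I"
  by (simp add: parabolic_value_def algebra_simps sum.distrib)

lemma parabolic_value_cmult:
  "parabolic_value a b c (k * z) (\<lambda>v. k * D v) (\<lambda>h v. k * H h v) = k * parabolic_value a b c z D H"
  by (simp add: parabolic_value_def algebra_simps sum_distrib_left)

lemma parabolic_value_compose:
  "parabolic_value a b c y (\<lambda>v. l * D v) (\<lambda>h v. l * H h v + m * D h * D v) =
   m * (\<Sum>i\<in>UNIV. \<Sum>j\<in>UNIV. a i j * D (axis i 1, 0) * D (axis j 1, 0)) +
   l * parabolic_value a b 0 0 D H + c * y"
  by (simp add: parabolic_value_def algebra_simps sum.distrib sum_distrib_left)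

text \<open>Barriers have to be subsolutions for all coefficients at once, so only these pointwise bounds
  on the coefficients enter; the arguments are values at one space-time point.\<close>

definition admissible_at ::
  "real \<Rightarrow> real \<Rightarrow> ('n::finite \<Rightarrow> 'n \<Rightarrow> real) \<Rightarrow> ('n \<Rightarrow> real) \<Rightarrow> real \<Rightarrow> bool" where
  "admissible_at lam Lam a b c \<longleftrightarrow>
     (\<forall>i j. \<bar>a i j\<bar> \<le> Lam) \<and> (\<forall>i. \<bar>b i\<bar> \<le> Lam) \<and> \<bar>c\<bar> \<le> Lam \<and>
     (\<forall>\<xi>::real^'n. lam * (norm \<xi>)\<^sup>2 \<le> (\<Sum>i\<in>UNIV. \<Sum>j\<in>UNIV. a i j * \<xi>$i * \<xi>$j))"

definition supersolution ::
  "(real^'n::finite) set \<Rightarrow> real \<Rightarrow> real \<Rightarrow> real \<Rightarrow> real \<Rightarrow> ((real^'n) \<times> real \<Rightarrow> real) \<Rightarrow> bool" where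
  "supersolution \<Omega> T lam Lam \<epsilon> u \<longleftrightarrow>
     lsc_on (closure \<Omega> \<times> {0..T}) u \<and> (\<forall>p \<in> parabolic_boundary \<Omega> T. 0 \<le> u p) \<and>
     (\<exists>a b c. coeff_conds \<Omega> T lam Lam a b c \<and> viscosity_le \<Omega> T a b c u \<epsilon>)"

lemma supersolution_mono:
  "supersolution \<Omega> T lam Lam \<epsilon> u \<Longrightarrow> \<epsilon> \<le> \<epsilon>' \<Longrightarrow> supersolution \<Omega> T lam Lam \<epsilon>' u"
  unfolding supersolution_def viscosity_le_def by (meson order_trans)

lemma coeff_conds_admissible_at:
  assumes "coeff_conds \<Omega> T lam Lam a b c" "p \<in> \<Omega> \<times> {0<..T}"
  shows "admissible_at lam Lam (\<lambda>i j. a i j p) (\<lambda>i. b i p) (c p)"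
proof -
  have *: "\<bar>a i j p\<bar> + \<bar>b i p\<bar> + \<bar>c p\<bar> \<le> Lam" for i j
    using assms unfolding coeff_conds_def by blast
  have "\<bar>a i j p\<bar> \<le> Lam" "\<bar>b i p\<bar> \<le> Lam" "\<bar>c p\<bar> \<le> Lam" for i j
    using *[of i j] by linarith+
  then show ?thesis
    using assms unfolding coeff_conds_def admissible_at_def by blast
qed

section \<open>Comparison with classical subsolutions\<close>

lemma lsc_on_attains_min:
  assumes K: "compact K" "K \<noteq> {}" and G: "lsc_on K G"
  shows "\<exists>p\<in>K. \<forall>q\<in>K. G p \<le> G q"
proof (rule ccontr)
  assume "\<not> ?thesis"
  then have "\<forall>p\<in>K. \<exists>q\<in>K. G q < G p" by (meson not_le)
  then obtain f where f: "\<And>p. p \<in> K \<Longrightarrow> f p \<in> K" "\<And>p. p \<in> K \<Longrightarrow> G (f p) < G p" by metis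
  have "\<exists>V. open V \<and> p \<in> V \<and> (\<forall>q\<in>V \<inter> K. G (f p) < G q)" if "p \<in> K" for p
  proof -
    have "\<forall>\<^sub>F q in at p within K. G (f p) < G q"
      using G f that unfolding lsc_on_def by blast
    then show ?thesis
      using f(2)[OF that] unfolding eventually_at_topological by (metis IntD1 IntD2)
  qed
  then obtain V where V: "\<And>p. p \<in> K \<Longrightarrow> open (V p)" "\<And>p. p \<in> K \<Longrightarrow> p \<in> V p"
    "\<And>p q. p \<in> K \<Longrightarrow> q \<in> V p \<Longrightarrow> q \<in> K \<Longrightarrow> G (f p) < G q"
    by (metis IntI)
  have "K \<subseteq> (\<Union>p\<in>K. V p)" using V(2) by blast
  then obtain C where C: "C \<subseteq> K" "finite C" "K \<subseteq> (\<Union>p\<in>C. V p)"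
    using compactE_image[OF K(1), of K V] V(1) by metis
  then have "C \<noteq> {}" using K(2) by auto
  then obtain q where q: "q \<in> C" "\<And>p. p \<in> C \<Longrightarrow> G (f q) \<le> G (f p)"
    using C(2) arg_min_if_finite(1)[of C "\<lambda>q. G (f q)"] arg_min_least[of C _ "\<lambda>q. G (f q)"] by blast
  have "f q \<in> K" using f(1) C(1) q(1) by blast
  then obtain p where "p \<in> C" "f q \<in> V p" using C(3) by blast
  then have "G (f p) < G (f q)" using V(3) C(1) \<open>f q \<in> K\<close> by blast
  with q(2)[OF \<open>p \<in> C\<close>] show False by simp
qed

lemma lsc_on_subset: "lsc_on S u \<Longrightarrow> K \<subseteq> S \<Longrightarrow> lsc_on K u"
  unfolding lsc_on_def by (meson at_le filter_leD subset_eq)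

text \<open>Dividing by \<open>\<theta>\<close> is what allows pushing a barrier down by a multiple of \<open>\<theta>\<close> instead of a
  constant.\<close>

lemma lsc_on_diff_divide:
  fixes u :: "'a::topological_space \<Rightarrow> real"
  assumes u: "lsc_on K u" and \<phi>: "continuous_on UNIV \<phi>"
    and \<theta>: "continuous_on UNIV \<theta>" "\<And>p. 0 < \<theta> p"
  shows "lsc_on K (\<lambda>p. (u p - \<phi> p) / \<theta> p)"
  unfolding lsc_on_def
proof (intro ballI allI impI)
  fix p s assume p: "p \<in> K" and s: "s < (u p - \<phi> p) / \<theta> p"
  then have "\<phi> p + s * \<theta> p < u p"
    using \<theta>(2)[of p] by (simp add: field_simps)
  then obtain s' where s': "\<phi> p + s * \<theta> p < s'" "s' < u p" using dense by blast
  have 1: "\<forall>\<^sub>F q in at p within K. s' < u q"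
    using u p s'(2) unfolding lsc_on_def by blast
  have "continuous_on UNIV (\<lambda>q. \<phi> q + s * \<theta> q)"
    by (intro continuous_intros \<phi> \<theta>)
  then have "((\<lambda>q. \<phi> q + s * \<theta> q) \<longlongrightarrow> \<phi> p + s * \<theta> p) (at p)"
    by (simp add: continuous_on_def)
  then have "((\<lambda>q. \<phi> q + s * \<theta> q) \<longlongrightarrow> \<phi> p + s * \<theta> p) (at p within K)"
    by (rule tendsto_within_subset) simp
  from order_tendstoD(2)[OF this s'(1)] 1
  show "\<forall>\<^sub>F q in at p within K. s < (u q - \<phi> q) / \<theta> q"
  proof eventually_elim
    case (elim q)
    then show ?case using \<theta>(2)[of q] by (simp add: field_simps)
  qed
qed

lemma C2_jets_exp_time:
  "C2_jets (\<lambda>p::'a::euclidean_space \<times> real. exp (k * snd p))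
     (\<lambda>p v. k * exp (k * snd p) * snd v)
     (\<lambda>p h v. k * exp (k * snd p) * 0 + k * k * exp (k * snd p) * snd h * snd v)"
  by (rule C2_jets_compose[OF C2_jets_linear[OF bounded_linear_snd], where \<psi> = "\<lambda>z. exp (k * z)"])
    (auto intro!: derivative_eq_intros continuous_intros)

lemma parabolic_value_exp_time:
  "parabolic_value a b c e (\<lambda>v. k * e * snd v) (\<lambda>h v. k * e * 0 + k * k * e * snd h * snd v) = (c - k) * e"
  by (simp add: parabolic_value_def algebra_simps)

text \<open>Let \<open>m\<close> be the minimum of \<open>(u - \<phi>) / e\<^bsup>\<Lambda>t\<^esup>\<close> on \<open>K\<close>. If \<open>m < 0\<close>, then \<open>\<phi> + m e\<^bsup>\<Lambda>t\<^esup>\<close> touches \<open>u\<close> from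
  below at a point of \<open>W\<close>, and there \<open>(L - \<partial>\<^sub>t) (m e\<^bsup>\<Lambda>t\<^esup>) = m (c - \<Lambda>) e\<^bsup>\<Lambda>t\<^esup> \<ge> 0\<close>, so the strict
  inequality for \<open>\<phi>\<close> contradicts the viscosity inequality. Time \<open>T\<close> counts as interior,
  because there a test function lies below \<open>u\<close> at earlier times only; at a final time of \<open>K\<close> before \<open>T\<close> it
  would have to lie below \<open>u\<close> on both sides, so there \<open>\<phi> \<le> u\<close> is assumed in \<open>bdry\<close>.\<close>

lemma comparison_principle:
  fixes \<Omega> :: "(real^'n) set"
  assumes u: "supersolution \<Omega> T lam Lam \<epsilon> u"
    and \<phi>: "C2_jets \<phi> D H"
    and K: "compact K" "K \<subseteq> closure \<Omega> \<times> {0..T}"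
    and W: "open W" "W \<inter> (\<Omega> \<times> {0<..T}) \<subseteq> K"
    and strict: "\<And>p a b c. p \<in> W \<inter> (\<Omega> \<times> {0<..T}) \<Longrightarrow> admissible_at lam Lam a b c \<Longrightarrow>
        \<epsilon> < parabolic_value a b c (\<phi> p) (D p) (H p)"
    and bdry: "\<And>p. p \<in> K \<Longrightarrow> p \<notin> W \<inter> (\<Omega> \<times> {0<..T}) \<Longrightarrow> \<phi> p \<le> u p"
    and p: "p \<in> K"
  shows "\<phi> p \<le> u p"
proof (rule ccontr)
  assume neg: "\<not> \<phi> p \<le> u p"
  obtain a b c where coeff: "coeff_conds \<Omega> T lam Lam a b c" and visc: "viscosity_le \<Omega> T a b c u \<epsilon>"
    using u unfolding supersolution_def by blast
  define \<theta> where "\<theta> q = exp (Lam * snd q)" for q :: "(real^'n) \<times> real"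
  have \<theta>: "continuous_on UNIV \<theta>" "0 < \<theta> q" for q
    unfolding \<theta>_def[abs_def] by (auto intro!: continuous_intros)
  have "lsc_on K (\<lambda>q. (u q - \<phi> q) / \<theta> q)"
    using u K(2) by (intro lsc_on_diff_divide C2_jets_continuous[OF \<phi>] \<theta>)
      (auto simp: supersolution_def intro: lsc_on_subset)
  then obtain q where q: "q \<in> K" and min: "\<And>r. r \<in> K \<Longrightarrow> (u q - \<phi> q) / \<theta> q \<le> (u r - \<phi> r) / \<theta> r"
    using lsc_on_attains_min[OF K(1)] p by blast
  define m where "m = (u q - \<phi> q) / \<theta> q"
  have "m \<le> (u p - \<phi> p) / \<theta> p" using min[OF p] by (simp add: m_def)
  also have "\<dots> < 0" using neg \<theta>(2)[of p] by (simp add: divide_neg_pos)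
  finally have m: "m < 0" .
  have touch: "\<phi> r + m * \<theta> r \<le> u r" if "r \<in> K" for r
    using min[OF that] \<theta>(2)[of r] by (simp add: m_def[symmetric] field_simps)
  have eq: "\<phi> q + m * \<theta> q = u q" using \<theta>(2)[of q] by (simp add: m_def)
  have qW: "q \<in> W \<inter> (\<Omega> \<times> {0<..T})"
    using bdry[OF q] eq m \<theta>(2)[of q] mult_neg_pos[OF m \<theta>(2)[of q]] by force
  have adm: "admissible_at lam Lam (\<lambda>i j. a i j q) (\<lambda>i. b i q) (c q)"
    using coeff_conds_admissible_at[OF coeff] qW by blast
  note J = C2_jets_add[OF \<phi> C2_jets_cmult[OF C2_jets_exp_time[of Lam], of m]]
  have "L_op a b c (\<lambda>r. \<phi> r + m * \<theta> r) q - dt (\<lambda>r. \<phi> r + m * \<theta> r) q \<le> \<epsilon>"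
    using visc qW touch eq W(2) C2_jets_imp_C2_on[OF J W(1)]
    unfolding viscosity_le_def \<theta>_def[symmetric] by (meson Int_iff subsetD)
  then have "parabolic_value (\<lambda>i j. a i j q) (\<lambda>i. b i q) (c q) (\<phi> q) (D q) (H q) + m * ((c q - Lam) * \<theta> q) \<le> \<epsilon>"
    using L_op_eq_parabolic_value[OF J, of a b c q]
    unfolding parabolic_value_add parabolic_value_cmult parabolic_value_exp_time
    by (simp add: \<theta>_def)
  moreover have "0 \<le> m * ((c q - Lam) * \<theta> q)"
    using m adm \<theta>(2)[of q] by (intro mult_nonpos_nonpos) (auto simp: admissible_at_def intro!: mult_nonpos_nonneg)
  ultimately show False using strict[OF qW adm] by linarith
qed

text \<open>The corrector \<open>- 2 \<epsilon> e\<^bsup>(\<Lambda> + 1) t\<^esup>\<close> has \<open>(L - \<partial>\<^sub>t)\<close>-value larger than \<open>\<epsilon>\<close>. Adding it turns a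
  subsolution into one that is strict enough for comparison with \<open>u\<close>.\<close>

lemma decay_strict:
  fixes \<epsilon> :: real
  assumes "0 < \<epsilon>" "0 < Lam" "\<bar>c\<bar> \<le> Lam" "0 \<le> t"
  shows "\<epsilon> < - 2 * \<epsilon> * ((c - (Lam + 1)) * exp ((Lam + 1) * t))"
proof -
  define e where "e = exp ((Lam + 1) * t)"
  have "1 \<le> e" using assms by (auto simp: e_def)
  moreover have "1 \<le> Lam + 1 - c" using assms by auto
  ultimately have "1 * 1 \<le> (Lam + 1 - c) * e" by (intro mult_mono) auto
  then have "2 * \<epsilon> * 1 \<le> 2 * \<epsilon> * ((Lam + 1 - c) * e)"
    using assms by (intro mult_left_mono) auto
  also have "\<dots> = - 2 * \<epsilon> * ((c - (Lam + 1)) * e)" by algebra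
  finally show ?thesis using assms unfolding e_def by linarith
qed

lemma compact_cylinder:
  fixes \<Omega> :: "(real^'n) set"
  shows "bounded \<Omega> \<Longrightarrow> compact (closure \<Omega> \<times> {s..t::real})"
  by (intro compact_Times) (auto simp: compact_closure)

lemma closure_minus_open: "open \<Omega> \<Longrightarrow> x \<in> closure \<Omega> \<Longrightarrow> x \<notin> \<Omega> \<Longrightarrow> x \<in> frontier \<Omega>"
  by (simp add: frontier_def interior_open)

lemma supersolution_lower_bound:
  fixes \<Omega> :: "(real^'n) set"
  assumes \<Omega>: "open \<Omega>" "bounded \<Omega>" and u: "supersolution \<Omega> T lam Lam \<epsilon> u" and \<epsilon>: "0 < \<epsilon>"
    and Lam: "0 < Lam" and x: "x \<in> closure \<Omega>" "t \<in> {0..T}"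
  shows "- 2 * \<epsilon> * exp ((Lam + 1) * t) \<le> u (x, t)"
proof -
  define \<phi> where "\<phi> p = - 2 * \<epsilon> * exp ((Lam + 1) * snd p)" for p :: "(real^'n) \<times> real"
  note J = C2_jets_cmult[OF C2_jets_exp_time[where 'a = "real^'n" and k = "Lam + 1"], of "- 2 * \<epsilon>", folded \<phi>_def]
  have "\<phi> (x, t) \<le> u (x, t)"
  proof (rule comparison_principle[OF u J, where K = "closure \<Omega> \<times> {0..T}" and W = UNIV])
    fix p and a :: "'n \<Rightarrow> 'n \<Rightarrow> real" and b c
    assume p: "p \<in> UNIV \<inter> \<Omega> \<times> {0<..T}" and adm: "admissible_at lam Lam a b c"
    have "\<epsilon> < - 2 * \<epsilon> * ((c - (Lam + 1)) * exp ((Lam + 1) * snd p))"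
      using p adm \<epsilon> Lam by (intro decay_strict) (auto simp: admissible_at_def)
    then show "\<epsilon> < parabolic_value a b c (\<phi> p) (\<lambda>v. - 2 * \<epsilon> * ((Lam + 1) * exp ((Lam + 1) * snd p) * snd v))
        (\<lambda>h v. - 2 * \<epsilon> * ((Lam + 1) * exp ((Lam + 1) * snd p) * 0 + (Lam + 1) * (Lam + 1) * exp ((Lam + 1) * snd p) * snd h * snd v))"
      unfolding \<phi>_def parabolic_value_cmult parabolic_value_exp_time .
  next
    fix p assume p: "p \<in> closure \<Omega> \<times> {0..T}" "p \<notin> UNIV \<inter> \<Omega> \<times> {0<..T}"
    then have "p \<in> parabolic_boundary \<Omega> T"
      using closure_minus_open[OF \<Omega>(1)] by (auto simp: parabolic_boundary_def)
    then have "0 \<le> u p" using u by (auto simp: supersolution_def)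
    moreover have "\<phi> p \<le> 0" using \<epsilon> by (simp add: \<phi>_def mult_le_0_iff)
    ultimately show "\<phi> p \<le> u p" by linarith
  qed (use \<Omega> x compact_cylinder subsetD[OF closure_subset] in auto)
  then show ?thesis by (simp add: \<phi>_def)
qed

section \<open>Expansion of positivity in the interior\<close>

text \<open>Used for the exponents 3 and 2: the cube of the positive part is \<open>C\<^sup>2\<close>.\<close>

lemma has_real_derivative_positive_part_power:
  "((\<lambda>z. (max 0 z) ^ Suc (Suc n)) has_real_derivative real (Suc (Suc n)) * (max 0 z) ^ Suc n) (at z)"
proof (cases z "0::real" rule: linorder_cases)
  case less
  have "((\<lambda>_. 0) has_real_derivative 0) (at z)" by simp
  then have "((\<lambda>z. (max 0 z) ^ Suc (Suc n)) has_real_derivative 0) (at z)"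
    by (rule has_field_derivative_transform_within_open[where S = "{..<0}"]) (use less in auto)
  then show ?thesis using less by simp
next
  case greater
  have "((\<lambda>z. z ^ Suc (Suc n)) has_real_derivative real (Suc (Suc n)) * z ^ Suc n) (at z)"
    by (rule derivative_eq_intros refl | simp)+
  then have "((\<lambda>z. (max 0 z) ^ Suc (Suc n)) has_real_derivative real (Suc (Suc n)) * z ^ Suc n) (at z)"
    by (rule has_field_derivative_transform_within_open[where S = "{0<..}"]) (use greater in auto)
  then show ?thesis using greater by simp
next
  case equal
  have "((\<lambda>h::real. (max 0 h) ^ Suc (Suc n) / h) \<longlongrightarrow> 0) (at 0)"
  proof (rule Lim_null_comparison)
    show "\<forall>\<^sub>F h::real in at 0. norm ((max 0 h) ^ Suc (Suc n) / h) \<le> \<bar>h\<bar> ^ Suc n"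
      by (rule always_eventually) (auto simp: max_def intro: mult_nonpos_nonneg)
    have "((\<lambda>h::real. \<bar>h\<bar> ^ Suc n) \<longlongrightarrow> \<bar>0\<bar> ^ Suc n) (at 0)"
      by (intro tendsto_intros)
    then show "((\<lambda>h::real. \<bar>h\<bar> ^ Suc n) \<longlongrightarrow> 0) (at 0)" by simp
  qed
  then show ?thesis using equal by (simp add: DERIV_def)
qed

text \<open>Here \<open>h\<close> is the value of \<open>m(t) - |x - z|\<^sup>2\<close>, \<open>S\<close> is the quadratic form of the coefficients at its gradient,
  and \<open>L\<close> collects its second order, drift and time derivative terms. Up to the factor \<open>e\<^bsup>- A t\<^esup>\<close> the
  right-hand side is the operator applied to \<open>e\<^bsup>- A t\<^esup> h\<^sup>3\<close>. After division by \<open>h\<close> it is at least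
  \<open>24 w - y + y\<^sup>2 / w\<close> with \<open>w = \<lambda> s\<^sup>2\<close> and \<open>y = (24 \<lambda> + 3 B) h\<close>, which is positive as a quadratic form
  in \<open>y\<close> and \<open>w\<close>. The decay rate \<open>A\<close> is chosen to produce the term \<open>y\<^sup>2 / w\<close>.\<close>

lemma expanding_barrier_inequality:
  fixes h :: real
  assumes lam: "0 < lam" and s: "0 < s" and h: "0 \<le> h"
    and S: "4 * lam * (s\<^sup>2 - h) \<le> S" and L: "- B \<le> L" and c: "- Lam \<le> c"
    and A: "A = Lam + (24 * lam + 3 * B)\<^sup>2 / (lam * s\<^sup>2)"
  shows "0 \<le> 6 * h * S + 3 * h\<^sup>2 * L + (c + A) * h ^ 3"
proof -
  define w where "w = lam * s\<^sup>2"
  define y where "y = (24 * lam + 3 * B) * h"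
  have w: "0 < w" using lam s by (simp add: w_def)
  have "0 \<le> (y - w / 2)\<^sup>2 + 23 * w\<^sup>2 + 3 / 4 * w\<^sup>2" by (intro add_nonneg_nonneg) auto
  also have "\<dots> = y\<^sup>2 - y * w + 24 * w\<^sup>2" by (simp add: power2_eq_square field_simps)
  finally have "0 \<le> (y\<^sup>2 - y * w + 24 * w\<^sup>2) / w" using w by simp
  also have "\<dots> = 24 * w - y + y\<^sup>2 / w" using w by (simp add: field_simps power2_eq_square)
  also have "y\<^sup>2 / w \<le> (c + A) * h\<^sup>2"
  proof -
    have "y\<^sup>2 / w = (24 * lam + 3 * B)\<^sup>2 / (lam * s\<^sup>2) * h\<^sup>2"
      by (simp add: y_def w_def power_mult_distrib)
    also have "\<dots> \<le> (c + A) * h\<^sup>2" using A c by (intro mult_right_mono) auto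
    finally show ?thesis .
  qed
  also have "24 * w - y + (c + A) * h\<^sup>2 \<le> 6 * S + 3 * h * L + (c + A) * h\<^sup>2"
  proof -
    have "3 * h * (- B) \<le> 3 * h * L" using L h by (intro mult_left_mono) auto
    then show ?thesis using S by (simp add: w_def y_def algebra_simps)
  qed
  finally have "0 \<le> h * (6 * S + 3 * h * L + (c + A) * h\<^sup>2)"
    using h by simp
  then show ?thesis by (simp add: algebra_simps power2_eq_square power3_eq_cube)
qed

lemma sum_axis: "(\<Sum>i\<in>UNIV. \<Sum>j\<in>UNIV. a i j * (axis i (1::real) \<bullet> axis j 1)) = (\<Sum>i\<in>UNIV. a i i)"
  for a :: "'n::finite \<Rightarrow> 'n \<Rightarrow> real"
  by (simp add: inner_axis_axis if_distrib[of "\<lambda>x. _ * x"] cong: if_cong)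

lemma parabolic_value_distance:
  fixes x z :: "real^'n" and Lam :: real
  assumes adm: "admissible_at lam Lam a b c"
  shows "\<bar>parabolic_value a b 0 0 (\<lambda>v. 2 * ((x - z) \<bullet> fst v)) (\<lambda>h v. 2 * (fst h \<bullet> fst v))\<bar>
    \<le> 2 * CARD('n) * Lam * (1 + norm (x - z))"
proof -
  have "\<bar>\<Sum>i\<in>UNIV. a i i\<bar> \<le> (\<Sum>i\<in>(UNIV::'n set). Lam)"
    using adm by (intro order_trans[OF sum_abs] sum_mono) (auto simp: admissible_at_def)
  moreover have "\<bar>\<Sum>i\<in>UNIV. b i * (x - z) $ i\<bar> \<le> (\<Sum>i\<in>(UNIV::'n set). Lam * norm (x - z))"
    using adm component_le_norm_cart[of "x - z"]
    by (intro order_trans[OF sum_abs] sum_mono) (auto simp: admissible_at_def abs_mult intro!: mult_mono)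
  moreover have "(\<Sum>i\<in>UNIV. \<Sum>j\<in>UNIV. a i j * (2 * (axis i (1::real) \<bullet> axis j 1))) = 2 * (\<Sum>i\<in>UNIV. a i i)"
    unfolding sum_axis[of a, symmetric] by (simp add: sum_distrib_left mult_ac)
  moreover have "(\<Sum>i\<in>UNIV. b i * (2 * ((x - z) \<bullet> axis i 1))) = 2 * (\<Sum>i\<in>UNIV. b i * (x - z) $ i)"
    by (simp add: inner_axis sum_distrib_left mult_ac)
  ultimately show ?thesis
    by (simp add: parabolic_value_def algebra_simps)
qed

lemma admissible_at_elliptic:
  fixes D :: "(real^'n) \<times> real \<Rightarrow> real"
  assumes "admissible_at lam Lam a b c" "\<And>i. \<xi> $ i = D (axis i 1, 0)"
  shows "lam * (norm \<xi>)\<^sup>2 \<le> (\<Sum>i\<in>UNIV. \<Sum>j\<in>UNIV. a i j * D (axis i 1, 0) * D (axis j 1, 0))"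
proof -
  have "lam * (norm \<xi>)\<^sup>2 \<le> (\<Sum>i\<in>UNIV. \<Sum>j\<in>UNIV. a i j * \<xi>$i * \<xi>$j)"
    using assms(1) unfolding admissible_at_def by blast
  then show ?thesis by (simp only: assms(2))
qed

lemma parabolic_value_time_factor:
  "parabolic_value a b c (e * z) (\<lambda>v. e * D v + k * e * snd v * z)
     (\<lambda>h v. e * H h v + k * e * snd h * D v +
        (k * e * snd v * D h + (k * e * 0 + k * k * e * snd h * snd v) * z)) =
   e * (parabolic_value a b c z D H - k * z)"
  by (simp add: parabolic_value_def algebra_simps sum_distrib_left)

text \<open>The squared radius \<open>R\<^sup>2 - (R\<^sup>2 - s\<^sup>2) e\<^bsup>- \<beta> (t - t\<^sub>0)\<^esup>\<close> equals \<open>s\<^sup>2\<close> at time \<open>t\<^sub>0\<close> and never reaches \<open>R\<^sup>2\<close>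
  unless \<open>s = R\<close>, so the support of the barrier stays in the ball of radius \<open>R\<close> up to time \<open>T\<close>, however fast it
  expands. The factor \<open>\<kappa> / s\<^sup>6\<close> makes the barrier at most \<open>\<kappa>\<close> at time \<open>t\<^sub>0\<close>.\<close>

lemma expanding_barrier:
  fixes \<Omega> :: "(real^'n) set" and lam Lam R s \<beta> \<kappa> t0 :: real
  assumes \<Omega>: "open \<Omega>" "bounded \<Omega>" and u: "supersolution \<Omega> T lam Lam \<epsilon> u" and \<epsilon>: "0 < \<epsilon>"
    and lam: "0 < lam" and Lam: "0 < Lam" and s: "0 < s" "s \<le> R" and \<beta>: "0 \<le> \<beta>" and \<kappa>: "0 < \<kappa>"
    and ball: "ball z R \<subseteq> \<Omega>" and t0: "0 \<le> t0"
    and init: "\<And>x. x \<in> ball z s \<Longrightarrow> \<kappa> \<le> u (x, t0)"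
    and A: "A = Lam + (24 * lam + 3 * (2 * CARD('n) * Lam * (1 + R) + \<beta> * R\<^sup>2))\<^sup>2 / (lam * s\<^sup>2)"
    and x: "x \<in> closure \<Omega>" and t: "t \<in> {t0..T}"
  shows "\<kappa> / s ^ 6 * (exp (- A * (t - t0)) * max 0 (R\<^sup>2 - (R\<^sup>2 - s\<^sup>2) * exp (- \<beta> * (t - t0)) - (norm (x - z))\<^sup>2) ^ 3)
    - 2 * \<epsilon> * exp ((Lam + 1) * t) \<le> u (x, t)"
proof -
  \<comment> \<open>Functions of \<open>t - t\<^sub>0\<close> are written as functions of \<open>t\<close>; the factors \<open>q\<close> and \<open>k\<close> absorb the shift.\<close>
  define q where "q = (R\<^sup>2 - s\<^sup>2) * exp (\<beta> * t0)"
  define k where "k = \<kappa> / s ^ 6 * exp (A * t0)"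
  define h where "h p = R\<^sup>2 + (- q * exp (- \<beta> * snd p) + - 1 * (norm (fst p - z))\<^sup>2)"
    for p :: "(real^'n) \<times> real"
  define \<phi> where "\<phi> p = k * (exp (- A * snd p) * max 0 (h p) ^ 3) + - 2 * \<epsilon> * exp ((Lam + 1) * snd p)"
    for p :: "(real^'n) \<times> real"
  \<comment> \<open>Unsimplified, as the rules for sums, multiples and compositions produce them.\<close>
  define Dh where "Dh = (\<lambda>(p::(real^'n) \<times> real) v. 0 + (- q * (- \<beta> * exp (- \<beta> * snd p) * snd v) +
       - 1 * (2 * ((fst p - z) \<bullet> fst v))))"
  define Hh where "Hh = (\<lambda>(p::(real^'n) \<times> real) (w::(real^'n) \<times> real) v. 0 + (- q * (- \<beta> * exp (- \<beta> * snd p) * 0 +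
       - \<beta> * - \<beta> * exp (- \<beta> * snd p) * snd w * snd v) + - 1 * (2 * (fst w \<bullet> fst v))))"
  have sR: "s\<^sup>2 \<le> R\<^sup>2" using s by (intro power_mono) auto
  have q: "0 \<le> q" using sR by (simp add: q_def)
  have k: "0 < k" using \<kappa> s by (simp add: k_def)
  have Jh: "C2_jets h Dh Hh"
    unfolding h_def[abs_def] Dh_def Hh_def
    by (intro C2_jets_add C2_jets_const C2_jets_cmult C2_jets_exp_time C2_jets_fst C2_jets_norm_square)
  have d1: "((\<lambda>z::real. max 0 z ^ 3) has_real_derivative 3 * (max 0 z)\<^sup>2) (at z)" for z
    using has_real_derivative_positive_part_power[of 1 z] by (simp add: numeral_eq_Suc)
  have d2: "((\<lambda>z::real. 3 * (max 0 z)\<^sup>2) has_real_derivative 6 * max 0 z) (at z)" for z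
    using DERIV_cmult[OF has_real_derivative_positive_part_power[of 0 z], of 3] by (simp add: numeral_eq_Suc)
  have c2: "continuous_on UNIV (\<lambda>z::real. 6 * max 0 z)" by (intro continuous_intros)
  note JP = C2_jets_compose[OF Jh d1 d2 c2]
  note J0 = C2_jets_add[OF C2_jets_cmult[OF C2_jets_mult[OF C2_jets_exp_time[of "- A"] JP], of k]
      C2_jets_cmult[OF C2_jets_exp_time[of "Lam + 1"], of "- 2 * \<epsilon>"], folded \<phi>_def]
  define S where "S a p = (\<Sum>i\<in>UNIV. \<Sum>j\<in>UNIV. a i j * Dh p (axis i 1, 0) * Dh p (axis j 1, 0))"
    for a :: "'n \<Rightarrow> 'n \<Rightarrow> real" and p
  define L where "L a b p = parabolic_value a b 0 0 (Dh p) (Hh p)" for a b p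
  obtain D H where J: "C2_jets \<phi> D H"
    and val: "\<And>a b (c::real) p. parabolic_value a b c (\<phi> p) (D p) (H p) =
        k * (exp (- A * snd p) * (6 * max 0 (h p) * S a p + 3 * (max 0 (h p))\<^sup>2 * L a b p +
          c * max 0 (h p) ^ 3 - - A * max 0 (h p) ^ 3)) +
         - 2 * \<epsilon> * ((c - (Lam + 1)) * exp ((Lam + 1) * snd p))"
    by (rule that[OF J0]) (unfold \<phi>_def S_def L_def parabolic_value_add parabolic_value_cmult
        parabolic_value_exp_time parabolic_value_time_factor parabolic_value_compose, rule refl)
  have exp_shift: "q * exp (- \<beta> * t') = (R\<^sup>2 - s\<^sup>2) * exp (- \<beta> * (t' - t0))" for t'
    by (simp add: q_def exp_add[symmetric] algebra_simps exp_diff exp_minus field_simps)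
  have radius: "s\<^sup>2 \<le> R\<^sup>2 - q * exp (- \<beta> * t')" if "t0 \<le> t'" for t'
  proof -
    have "(R\<^sup>2 - s\<^sup>2) * exp (- \<beta> * (t' - t0)) \<le> (R\<^sup>2 - s\<^sup>2) * 1"
      using sR \<beta> that by (intro mult_left_mono) auto
    then show ?thesis unfolding exp_shift by simp
  qed
  have outside: "h p \<le> 0" if "R \<le> norm (fst p - z)" for p
  proof -
    have "R\<^sup>2 \<le> (norm (fst p - z))\<^sup>2" using that s by (intro power_mono) auto
    moreover have "0 \<le> q * exp (- \<beta> * snd p)" using q by simp
    ultimately show ?thesis unfolding h_def by linarith
  qed
  have "\<phi> (x, t) \<le> u (x, t)"
  proof (rule comparison_principle[OF u J, where K = "closure \<Omega> \<times> {t0..T}" and W = "UNIV \<times> {t0<..}"])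
    fix p :: "(real^'n) \<times> real" and a :: "'n \<Rightarrow> 'n \<Rightarrow> real" and b c
    assume p: "p \<in> UNIV \<times> {t0<..} \<inter> \<Omega> \<times> {0<..T}" and adm: "admissible_at lam Lam a b c"
    have tp: "t0 \<le> snd p" "0 \<le> snd p" using p t0 by auto
    define Hp where "Hp = max 0 (h p)"
    \<comment> \<open>Outside the support all terms vanish together with \<open>Hp\<close>; inside, the algebraic inequality applies.\<close>
    have core: "0 \<le> 6 * Hp * S a p + 3 * Hp\<^sup>2 * L a b p + (c + A) * Hp ^ 3"
    proof (cases "0 < h p")
      case False
      then have "Hp = 0" by (simp add: Hp_def)
      then show ?thesis by simp
    next
      case True
      then have Hp: "Hp = h p" by (simp add: Hp_def)
      have norm_R: "norm (fst p - z) \<le> R" using outside[of p] True by linarith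
      show ?thesis
      proof (rule expanding_barrier_inequality[OF lam s(1) _ _ _ _ A])
        have "(-2 *\<^sub>R (fst p - z)) $ i = Dh p (axis i 1, 0)" for i
          by (simp add: Dh_def inner_axis)
        from admissible_at_elliptic[OF adm this]
        have "lam * (norm (-2 *\<^sub>R (fst p - z)))\<^sup>2 \<le> S a p" unfolding S_def .
        moreover have "(norm (-2 *\<^sub>R (fst p - z)))\<^sup>2 = 4 * (norm (fst p - z))\<^sup>2"
          by (simp add: power_mult_distrib)
        moreover have "s\<^sup>2 - Hp \<le> (norm (fst p - z))\<^sup>2"
          using radius[OF tp(1)] unfolding Hp h_def by linarith
        then have "4 * lam * (s\<^sup>2 - Hp) \<le> 4 * lam * (norm (fst p - z))\<^sup>2"
          using lam by (intro mult_left_mono) auto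
        ultimately show "4 * lam * (s\<^sup>2 - Hp) \<le> S a p" by (simp add: mult_ac)
      next
        have "L a b p = - parabolic_value a b 0 0 (\<lambda>v. 2 * ((fst p - z) \<bullet> fst v)) (\<lambda>h v. 2 * (fst h \<bullet> fst v))
             - \<beta> * (q * exp (- \<beta> * snd p))"
          by (simp add: L_def Dh_def Hh_def parabolic_value_def sum_negf sum_subtractf algebra_simps)
        moreover have "2 * CARD('n) * Lam * (1 + norm (fst p - z)) \<le> 2 * CARD('n) * Lam * (1 + R)"
          using Lam norm_R by (intro mult_left_mono) auto
        moreover have "\<beta> * (q * exp (- \<beta> * snd p)) \<le> \<beta> * R\<^sup>2"
        proof (intro mult_left_mono \<beta>)
          have "s\<^sup>2 \<le> R\<^sup>2 - q * exp (- \<beta> * snd p)" by (rule radius[OF tp(1)])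
          then show "q * exp (- \<beta> * snd p) \<le> R\<^sup>2" using zero_le_power2[of s] by linarith
        qed
        ultimately show "- (2 * CARD('n) * Lam * (1 + R) + \<beta> * R\<^sup>2) \<le> L a b p"
          using parabolic_value_distance[OF adm, of "fst p" z] by linarith
      qed (use adm in \<open>auto simp: admissible_at_def Hp_def abs_le_iff\<close>)
    qed
    have "0 \<le> k * (exp (- A * snd p) * (6 * Hp * S a p + 3 * Hp\<^sup>2 * L a b p + c * Hp ^ 3 - - A * Hp ^ 3))"
      using core k by (intro mult_nonneg_nonneg) (auto simp: algebra_simps)
    moreover have "\<epsilon> < - 2 * \<epsilon> * ((c - (Lam + 1)) * exp ((Lam + 1) * snd p))"
      using adm \<epsilon> Lam tp by (intro decay_strict) (auto simp: admissible_at_def)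
    ultimately have "\<epsilon> < k * (exp (- A * snd p) * (6 * Hp * S a p + 3 * Hp\<^sup>2 * L a b p + c * Hp ^ 3 - - A * Hp ^ 3)) +
         - 2 * \<epsilon> * ((c - (Lam + 1)) * exp ((Lam + 1) * snd p))"
      by linarith
    then show "\<epsilon> < parabolic_value a b c (\<phi> p) (D p) (H p)" unfolding val Hp_def[symmetric] .
  next
    fix p assume p: "p \<in> closure \<Omega> \<times> {t0..T}" "p \<notin> UNIV \<times> {t0<..} \<inter> \<Omega> \<times> {0<..T}"
    obtain x' t' where p_eq: "p = (x', t')" by (cases p)
    \<comment> \<open>On the lateral boundary and initially outside the small ball only the negative corrector is left.\<close>
    consider "x' \<notin> \<Omega>" | "t' = t0" "x' \<in> ball z s" | "t' = t0" "x' \<notin> ball z s" using p t0 p_eq by force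
    then show "\<phi> p \<le> u p"
    proof cases
      case 1
      then have "x' \<notin> ball z R" using ball by blast
      then have "h p \<le> 0" using outside[of p] by (simp add: p_eq dist_norm norm_minus_commute)
      then have "\<phi> p = - 2 * \<epsilon> * exp ((Lam + 1) * snd p)" by (simp add: \<phi>_def)
      moreover have "- 2 * \<epsilon> * exp ((Lam + 1) * snd p) \<le> 0" using \<epsilon> by (simp add: mult_le_0_iff)
      moreover have "p \<in> parabolic_boundary \<Omega> T"
        using 1 p(1) closure_minus_open[OF \<Omega>(1), of x'] t0 by (auto simp: p_eq parabolic_boundary_def)
      then have "0 \<le> u p" using u by (auto simp: supersolution_def)
      ultimately show ?thesis by linarith
    next
      case 2
      have ht0: "h p = s\<^sup>2 - (norm (x' - z))\<^sup>2"
        using exp_shift[of t0] by (simp add: h_def p_eq 2)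
      then have "max 0 (h p) \<le> s\<^sup>2" by simp
      then have "max 0 (h p) ^ 3 \<le> (s\<^sup>2) ^ 3" by (intro power_mono) auto
      then have "max 0 (h p) ^ 3 \<le> s ^ 6" by (simp flip: power_mult)
      then have "\<kappa> / s ^ 6 * max 0 (h p) ^ 3 \<le> \<kappa> / s ^ 6 * s ^ 6"
        using \<kappa> s by (intro mult_left_mono) auto
      also have "\<dots> = \<kappa>" using s by simp
      also have "\<kappa> \<le> u p" using init[of x'] 2 by (simp add: p_eq)
      finally have "\<kappa> / s ^ 6 * max 0 (h p) ^ 3 \<le> u p" .
      moreover have "k * (exp (- A * snd p) * max 0 (h p) ^ 3) = \<kappa> / s ^ 6 * max 0 (h p) ^ 3"
        by (simp add: k_def p_eq 2 exp_minus field_simps)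
      moreover have "- 2 * \<epsilon> * exp ((Lam + 1) * snd p) \<le> 0" using \<epsilon> by (simp add: mult_le_0_iff)
      ultimately show ?thesis unfolding \<phi>_def by linarith
    next
      case 3
      have "s\<^sup>2 \<le> (norm (x' - z))\<^sup>2"
        using 3(2) s by (intro power_mono) (auto simp: dist_norm norm_minus_commute)
      then have "h p \<le> 0"
        using exp_shift[of t0] by (simp add: h_def p_eq 3)
      then have "\<phi> p = - 2 * \<epsilon> * exp ((Lam + 1) * t0)" by (simp add: \<phi>_def p_eq 3)
      then show ?thesis
        using supersolution_lower_bound[OF \<Omega> u \<epsilon> Lam, of x' t0] p(1) t0 by (simp add: p_eq 3)
    qed
  next
    show "open (UNIV \<times> {t0<..} :: ((real^'n) \<times> real) set)" by (intro open_Times) auto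
    show "compact (closure \<Omega> \<times> {t0..T})" by (rule compact_cylinder[OF \<Omega>(2)])
    show "closure \<Omega> \<times> {t0..T} \<subseteq> closure \<Omega> \<times> {0..T}" using t0 by auto
    show "UNIV \<times> {t0<..} \<inter> \<Omega> \<times> {0<..T} \<subseteq> closure \<Omega> \<times> {t0..T}" using closure_subset by force
    show "(x, t) \<in> closure \<Omega> \<times> {t0..T}" using x t by auto
  qed
  moreover have "h (x, t) = R\<^sup>2 - (R\<^sup>2 - s\<^sup>2) * exp (- \<beta> * (t - t0)) - (norm (x - z))\<^sup>2"
    using exp_shift[of t] by (simp add: h_def)
  moreover have "k * exp (- A * t) = \<kappa> / s ^ 6 * exp (- A * (t - t0))"
    by (simp add: k_def exp_add[symmetric] exp_diff exp_minus algebra_simps field_simps)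
  ultimately show ?thesis
    unfolding \<phi>_def by (simp flip: mult.assoc)
qed

text \<open>The rate \<open>\<beta> = 4 / \<tau>\<close> makes the exponential at most \<open>e\<^bsup>-4\<^esup> \<le> 1/4\<close> after time \<open>\<tau>\<close>, so the
  expanding barrier is bounded below on the ball of radius \<open>R/2\<close>; then \<open>e\<close> is taken so small that the
  corrector does not spoil this bound. The constant does not depend on the centre or on the starting time.\<close>

lemma expansion_of_positivity:
  fixes \<Omega> :: "(real^'n) set" and lam Lam T R s \<tau> \<kappa> :: real
  assumes \<Omega>: "open \<Omega>" "bounded \<Omega>" and lam: "0 < lam" and Lam: "0 < Lam"
    and s: "0 < s" "s \<le> R" and \<tau>: "0 < \<tau>" and \<kappa>: "0 < \<kappa>"
  obtains e where "0 < e"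
    and "\<And>u z t0 x t. supersolution \<Omega> T lam Lam e u \<Longrightarrow> ball z R \<subseteq> \<Omega> \<Longrightarrow> 0 \<le> t0 \<Longrightarrow>
      (\<And>x. x \<in> ball z s \<Longrightarrow> \<kappa> \<le> u (x, t0)) \<Longrightarrow> x \<in> ball z (R / 2) \<Longrightarrow> t \<in> {t0 + \<tau>..T} \<Longrightarrow> e \<le> u (x, t)"
proof -
  define \<beta> where "\<beta> = 4 / \<tau>"
  define A where "A = Lam + (24 * lam + 3 * (2 * CARD('n) * Lam * (1 + R) + \<beta> * R\<^sup>2))\<^sup>2 / (lam * s\<^sup>2)"
  define \<delta> where "\<delta> = \<kappa> / s ^ 6 * (exp (- A * \<bar>T\<bar>) * (R\<^sup>2 / 4) ^ 3)"
  define M where "M = exp ((Lam + 1) * \<bar>T\<bar>)"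
  define e where "e = \<delta> / (1 + 2 * M)"
  have R: "0 < R" using s by linarith
  have \<beta>: "0 \<le> \<beta>" using \<tau> by (simp add: \<beta>_def)
  have A: "0 \<le> A" using lam Lam by (simp add: A_def)
  have M: "0 < M" by (simp add: M_def)
  have \<delta>: "0 < \<delta>" using \<kappa> s R by (simp add: \<delta>_def)
  then have e: "0 < e" using M by (simp add: e_def)
  have main: "e \<le> u (x, t)"
    if u: "supersolution \<Omega> T lam Lam e u" and ball: "ball z R \<subseteq> \<Omega>" and t0: "0 \<le> t0"
      and init: "\<And>x. x \<in> ball z s \<Longrightarrow> \<kappa> \<le> u (x, t0)" and x: "x \<in> ball z (R / 2)" and t: "t \<in> {t0 + \<tau>..T}"
    for u z t0 x t
  proof -
    define h where "h = R\<^sup>2 - (R\<^sup>2 - s\<^sup>2) * exp (- \<beta> * (t - t0)) - (norm (x - z))\<^sup>2"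
    have "x \<in> ball z R" using x R by auto
    then have "x \<in> closure \<Omega>" using ball closure_subset by blast
    then have "\<kappa> / s ^ 6 * (exp (- A * (t - t0)) * max 0 h ^ 3) - 2 * e * exp ((Lam + 1) * t) \<le> u (x, t)"
      unfolding h_def using t \<tau>
      by (intro expanding_barrier[OF \<Omega> u e lam Lam s \<beta> \<kappa> ball t0 init A_def]) auto
    moreover have "\<delta> \<le> \<kappa> / s ^ 6 * (exp (- A * (t - t0)) * max 0 h ^ 3)"
    proof -
      have "4 * 1 \<le> \<beta> * (t - t0)" using t \<tau> by (simp add: \<beta>_def field_simps)
      moreover have "1 + 4 \<le> exp (4::real)" by (rule exp_ge_add_one_self)
      ultimately have "5 \<le> exp (\<beta> * (t - t0))" by (smt (verit) exp_le_cancel_iff)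
      then have "1 / exp (\<beta> * (t - t0)) \<le> 1 / 4" by (simp only: divide_simps) auto
      then have "exp (- \<beta> * (t - t0)) \<le> 1 / 4" by (simp only: exp_minus inverse_eq_divide mult_minus_left)
      then have "(R\<^sup>2 - s\<^sup>2) * exp (- \<beta> * (t - t0)) \<le> R\<^sup>2 * (1 / 4)"
        using s by (intro mult_mono) (auto intro: power_mono)
      moreover have "(norm (x - z))\<^sup>2 \<le> (R / 2)\<^sup>2"
        using x by (intro power_mono) (auto simp: dist_norm norm_minus_commute)
      moreover have "(R / 2)\<^sup>2 = R\<^sup>2 / 4" by (simp add: power_divide)
      ultimately have "R\<^sup>2 / 4 \<le> h" using zero_le_power2[of R] unfolding h_def by linarith
      then have "(R\<^sup>2 / 4) ^ 3 \<le> max 0 h ^ 3" by (intro power_mono) auto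
      moreover have "A * (t - t0) \<le> A * \<bar>T\<bar>" using A t t0 by (intro mult_left_mono) auto
      ultimately show ?thesis
        unfolding \<delta>_def using \<kappa> s by (intro mult_left_mono mult_mono) auto
    qed
    moreover have "2 * e * exp ((Lam + 1) * t) \<le> 2 * e * M"
      unfolding M_def using e Lam t by (intro mult_left_mono) auto
    moreover have "1 + 2 * M \<noteq> 0" using M by linarith
    then have "e * (1 + 2 * M) = \<delta>" by (simp add: e_def)
    then have "e + 2 * e * M = \<delta>" by (simp add: algebra_simps)
    ultimately show ?thesis by linarith
  qed
  show ?thesis by (rule that[OF e]) (rule main)
qed

section \<open>Uniform positivity on compact subsets\<close>

text \<open>The property that a uniform lower bound holds near \<open>x\<close> after every positive time propagates from
  any point to any other point of a small ball: half of the available time is used to reach the first point and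
  half to expand. Connectedness of \<open>\<Omega>\<close> then propagates it from \<open>z\<close> to every point.\<close>

lemma positivity_near_interior_point:
  fixes \<Omega> :: "(real^'n) set" and lam Lam T r \<tau> :: real
  assumes \<Omega>: "open \<Omega>" "bounded \<Omega>" "connected \<Omega>" and lam: "0 < lam" and Lam: "0 < Lam"
    and r: "0 < r" and z: "ball z r \<subseteq> \<Omega>" and x: "x \<in> \<Omega>" and \<tau>: "0 < \<tau>"
  shows "\<exists>s>0. \<exists>e>0. \<forall>x'\<in>ball x s. \<forall>u. supersolution \<Omega> T lam Lam e u \<longrightarrow>
    (\<forall>w\<in>ball z r. 1 \<le> u (w, 0)) \<longrightarrow> (\<forall>t\<in>{\<tau>..T}. e \<le> u (x', t))"
proof -
  define P where "P x \<longleftrightarrow> (\<forall>\<tau>>0. \<exists>s>0. \<exists>e>0. \<forall>x'\<in>ball x s. \<forall>u. supersolution \<Omega> T lam Lam e u \<longrightarrow>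
    (\<forall>w\<in>ball z r. 1 \<le> u (w, 0)) \<longrightarrow> (\<forall>t\<in>{\<tau>..T}. e \<le> u (x', t)))" for x
  have "P x"
  proof (rule connected_induction_simple[OF \<Omega>(3) _ x, of z P])
    show "z \<in> \<Omega>" using z r by auto
    show "P z"
      unfolding P_def
    proof (intro allI impI)
      fix \<tau> :: real assume "0 < \<tau>"
      from expansion_of_positivity[OF \<Omega>(1,2) lam Lam r order_refl this zero_less_one]
      obtain e where "0 < e" and expand: "\<And>u z t0 x t. supersolution \<Omega> T lam Lam e u \<Longrightarrow>
          ball z r \<subseteq> \<Omega> \<Longrightarrow> 0 \<le> t0 \<Longrightarrow> (\<And>x. x \<in> ball z r \<Longrightarrow> 1 \<le> u (x, t0)) \<Longrightarrow>
          x \<in> ball z (r / 2) \<Longrightarrow> t \<in> {t0 + \<tau>..T} \<Longrightarrow> e \<le> u (x, t)"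
        by metis
      show "\<exists>s>0. \<exists>e>0. \<forall>x'\<in>ball z s. \<forall>u. supersolution \<Omega> T lam Lam e u \<longrightarrow>
          (\<forall>w\<in>ball z r. 1 \<le> u (w, 0)) \<longrightarrow> (\<forall>t\<in>{\<tau>..T}. e \<le> u (x', t))"
      proof (rule exI[of _ "r / 2"], rule conjI)
        show "\<exists>e>0. \<forall>x'\<in>ball z (r / 2). \<forall>u. supersolution \<Omega> T lam Lam e u \<longrightarrow>
            (\<forall>w\<in>ball z r. 1 \<le> u (w, 0)) \<longrightarrow> (\<forall>t\<in>{\<tau>..T}. e \<le> u (x', t))"
          using \<open>0 < e\<close> by (intro exI[of _ e] conjI ballI allI impI expand[OF _ z order_refl]) auto
      qed (use r in simp)
    qed
  next
    fix a assume "a \<in> \<Omega>"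
    then obtain \<eta> where "0 < \<eta>" "ball a \<eta> \<subseteq> \<Omega>" using \<Omega>(1) openE by blast
    then obtain \<delta> where \<delta>: "0 < \<delta>" "ball a (5 * \<delta>) \<subseteq> \<Omega>"
      by (intro that[of "\<eta> / 5"]) auto
    have "P y" if xy: "x \<in> ball a \<delta>" "y \<in> ball a \<delta>" and Px: "P x" for x y
      unfolding P_def
    proof (intro allI impI)
      fix \<tau> :: real assume \<tau>: "0 < \<tau>"
      then have \<tau>2: "0 < \<tau> / 2" by simp
      obtain s1 e1 where s1: "0 < s1" and e1: "0 < e1" and
        pos': "\<forall>x'\<in>ball x s1. \<forall>u. supersolution \<Omega> T lam Lam e1 u \<longrightarrow>
          (\<forall>w\<in>ball z r. 1 \<le> u (w, 0)) \<longrightarrow> (\<forall>t\<in>{\<tau>/2..T}. e1 \<le> u (x', t))"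
        using Px[unfolded P_def, rule_format, OF \<tau>2] by blast
      have pos: "e1 \<le> u (x', t)" if "x' \<in> ball x s1" "supersolution \<Omega> T lam Lam e1 u"
          "\<forall>w\<in>ball z r. 1 \<le> u (w, 0)" "t \<in> {\<tau>/2..T}" for x' u t
        using pos' that by blast
      \<comment> \<open>\<open>4 \<delta>\<close> is the target radius of the expansion, so that half of it covers every \<open>y\<close> in the ball about \<open>a\<close>.\<close>
      define s2 where "s2 = min s1 (4 * \<delta>)"
      have s2: "0 < s2" "s2 \<le> 4 * \<delta>" using s1 \<delta>(1) by (auto simp: s2_def)
      from expansion_of_positivity[OF \<Omega>(1,2) lam Lam s2 \<tau>2 e1]
      obtain e2 where e2: "0 < e2" and expand: "\<And>u z t0 x t. supersolution \<Omega> T lam Lam e2 u \<Longrightarrow>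
          ball z (4 * \<delta>) \<subseteq> \<Omega> \<Longrightarrow> 0 \<le> t0 \<Longrightarrow> (\<And>x. x \<in> ball z s2 \<Longrightarrow> e1 \<le> u (x, t0)) \<Longrightarrow>
          x \<in> ball z (4 * \<delta> / 2) \<Longrightarrow> t \<in> {t0 + \<tau> / 2..T} \<Longrightarrow> e2 \<le> u (x, t)"
        by metis
      have xball: "ball x (4 * \<delta>) \<subseteq> \<Omega>"
      proof (rule order_trans[OF _ \<delta>(2)], rule subsetI)
        fix w assume "w \<in> ball x (4 * \<delta>)"
        then show "w \<in> ball a (5 * \<delta>)" using xy(1) dist_triangle[of a w x] by simp
      qed
      have "y \<in> ball x (4 * \<delta> / 2)"
        using xy dist_triangle[of x y a] by (simp add: dist_commute)
      then obtain s where s: "0 < s" "ball y s \<subseteq> ball x (4 * \<delta> / 2)"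
        using openE[OF open_ball] by blast
      show "\<exists>s>0. \<exists>e>0. \<forall>x'\<in>ball y s. \<forall>u. supersolution \<Omega> T lam Lam e u \<longrightarrow>
          (\<forall>w\<in>ball z r. 1 \<le> u (w, 0)) \<longrightarrow> (\<forall>t\<in>{\<tau>..T}. e \<le> u (x', t))"
      proof (rule exI[of _ s], rule conjI, rule s(1), rule exI[of _ "min e1 e2"], intro conjI ballI allI impI)
        fix x' u t
        assume x': "x' \<in> ball y s" and u: "supersolution \<Omega> T lam Lam (min e1 e2) u"
          and init: "\<forall>w\<in>ball z r. 1 \<le> u (w, 0)" and t: "t \<in> {\<tau>..T}"
        have u1: "supersolution \<Omega> T lam Lam e1 u" and u2: "supersolution \<Omega> T lam Lam e2 u"
          by (auto intro: supersolution_mono[OF u])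
        have "e2 \<le> u (x', t)"
          using x' s t \<tau> by (intro expand[OF u2 xball, of "\<tau> / 2"] pos[OF _ u1 init]) (auto simp: s2_def)
        then show "min e1 e2 \<le> u (x', t)" by simp
      qed (use s e1 e2 in auto)
    qed
    note step = this
    have "ball a \<delta> \<subseteq> \<Omega>" using \<delta>(1) by (intro order_trans[OF _ \<delta>(2)] subset_ball) auto
    then have "openin (top_of_set \<Omega>) (ball a \<delta>)" by (simp add: openin_open_eq[OF \<Omega>(1)])
    moreover have "a \<in> ball a \<delta>" using \<delta>(1) by simp
    ultimately show "\<exists>U. openin (top_of_set \<Omega>) U \<and> a \<in> U \<and> (\<forall>x\<in>U. \<forall>y\<in>U. P x \<longrightarrow> P y)"
      using step by blast
  qed
  then show ?thesis using \<tau> unfolding P_def by blast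
qed

lemma compact_uniform_constant:
  fixes K :: "'a::metric_space set" and P :: "real \<Rightarrow> 'a \<Rightarrow> bool"
  assumes K: "compact K"
    and loc: "\<And>x. x \<in> K \<Longrightarrow> \<exists>\<delta>>0. \<exists>e>0. \<forall>x'\<in>ball x \<delta>. P e x'"
    and mono: "\<And>e e' x. P e x \<Longrightarrow> 0 < e' \<Longrightarrow> e' \<le> e \<Longrightarrow> P e' x"
  shows "\<exists>e>0. \<forall>x\<in>K. P e x"
proof -
  obtain \<delta> e where \<delta>: "\<And>x. x \<in> K \<Longrightarrow> 0 < \<delta> x" and e: "\<And>x. x \<in> K \<Longrightarrow> 0 < e x"
    and P: "\<And>x x'. x \<in> K \<Longrightarrow> x' \<in> ball x (\<delta> x) \<Longrightarrow> P (e x) x'"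
    using loc by metis
  have "K \<subseteq> (\<Union>x\<in>K. ball x (\<delta> x))" using \<delta> by force
  then obtain C where C: "C \<subseteq> K" "finite C" "K \<subseteq> (\<Union>x\<in>C. ball x (\<delta> x))"
    using compactE_image[OF K, of K "\<lambda>x. ball x (\<delta> x)"] by blast
  define m where "m = Min (insert 1 (e ` C))"
  have m: "0 < m" "\<And>x. x \<in> C \<Longrightarrow> m \<le> e x"
    using C(1,2) e by (auto simp: m_def)
  have "P m x" if "x \<in> K" for x
  proof -
    obtain c where "c \<in> C" "x \<in> ball c (\<delta> c)" using C(3) \<open>x \<in> K\<close> by blast
    then show ?thesis using P C(1) m mono by blast
  qed
  then show ?thesis using m(1) by blast
qed

text \<open>A ball of radius \<open>r\<close> contains the ball of radius \<open>r/2\<close> about every point at distance less than \<open>r/2\<close> from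
  its centre. Hence finitely many initial balls of radius \<open>r/2\<close> take care of all \<open>y\<close>, and the bound
  is uniform in the initial ball.\<close>

lemma interior_positivity:
  fixes \<Omega> :: "(real^'n) set" and lam Lam T r \<tau> :: real
  assumes \<Omega>: "open \<Omega>" "bounded \<Omega>" "connected \<Omega>" and lam: "0 < lam" and Lam: "0 < Lam"
    and r: "0 < r" and Z: "compact Z" "Z \<subseteq> \<Omega>" and \<tau>: "0 < \<tau>"
  shows "\<exists>e>0. \<forall>x\<in>Z. \<forall>y u. supersolution \<Omega> T lam Lam e u \<longrightarrow> ball y r \<subseteq> \<Omega> \<longrightarrow>
    (\<forall>w\<in>ball y r. 1 \<le> u (w, 0)) \<longrightarrow> (\<forall>t\<in>{\<tau>..T}. e \<le> u (x, t))"
proof -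
  define Q where "Q e B x \<longleftrightarrow> (\<forall>u. supersolution \<Omega> T lam Lam e u \<longrightarrow>
    (\<forall>w\<in>B. 1 \<le> u (w, 0)) \<longrightarrow> (\<forall>t\<in>{\<tau>..T}. e \<le> u (x, t)))" for e B x
  have Q_mono: "Q e' B' x" if "Q e B x" "e' \<le> e" "B \<subseteq> B'" for e e' B B' x
    using that supersolution_mono unfolding Q_def by (meson order_trans subset_eq)
  have "\<exists>e>0. \<forall>y\<in>closure \<Omega>. ball y r \<subseteq> \<Omega> \<longrightarrow> (\<forall>x\<in>Z. Q e (ball y r) x)"
  proof (rule compact_uniform_constant)
    show "compact (closure \<Omega>)" using \<Omega>(2) by (simp add: compact_closure)
  next
    fix y0 :: "real^'n"
    have sub: "ball y0 (r / 2) \<subseteq> ball y r" if "y \<in> ball y0 (r / 2)" for y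
    proof
      fix w assume "w \<in> ball y0 (r / 2)"
      then show "w \<in> ball y r" using that dist_triangle[of y w y0] by (simp add: dist_commute)
    qed
    show "\<exists>\<delta>>0. \<exists>e>0. \<forall>y\<in>ball y0 \<delta>. ball y r \<subseteq> \<Omega> \<longrightarrow> (\<forall>x\<in>Z. Q e (ball y r) x)"
    proof (cases "ball y0 (r / 2) \<subseteq> \<Omega>")
      case True
      have r2: "0 < r / 2" using r by simp
      have "\<exists>e>0. \<forall>x\<in>Z. Q e (ball y0 (r / 2)) x"
      proof (rule compact_uniform_constant[OF Z(1)])
        show "\<exists>\<delta>>0. \<exists>e>0. \<forall>x'\<in>ball x \<delta>. Q e (ball y0 (r / 2)) x'" if "x \<in> Z" for x
          using positivity_near_interior_point[OF \<Omega> lam Lam r2 True _ \<tau>, of x T] that Z(2)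
          unfolding Q_def by blast
      qed (use Q_mono in blast)
      then obtain e where "0 < e" "\<forall>x\<in>Z. Q e (ball y0 (r / 2)) x" by blast
      then show ?thesis using sub r2 Q_mono by (meson order_refl)
    next
      case False
      then have "\<not> ball y r \<subseteq> \<Omega>" if "y \<in> ball y0 (r / 2)" for y using sub[OF that] by blast
      then show ?thesis using r by (intro exI[of _ "r / 2"] exI[of _ 1]) auto
    qed
  qed (use Q_mono in blast)
  then obtain e where e: "0 < e" "\<And>y x. y \<in> closure \<Omega> \<Longrightarrow> ball y r \<subseteq> \<Omega> \<Longrightarrow> x \<in> Z \<Longrightarrow> Q e (ball y r) x"
    by blast
  have "y \<in> closure \<Omega>" if "ball y r \<subseteq> \<Omega>" for y
    using that r closure_subset by (meson centre_in_ball subsetD)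
  then show ?thesis using e unfolding Q_def by blast
qed

section \<open>Linear growth at the boundary\<close>

lemma parabolic_value_split:
  "parabolic_value a b c z D H = parabolic_value a b 0 0 D H + c * z"
  by (simp add: parabolic_value_def)

lemma parabolic_value_spacetime_distance:
  fixes p P :: "(real^'n) \<times> real" and Lam s :: real
  assumes adm: "admissible_at lam Lam a b c" and Lam: "0 < Lam" and s: "norm (p - P) \<le> s"
  shows "\<bar>parabolic_value a b 0 0 (\<lambda>v. 2 * ((p - P) \<bullet> v)) (\<lambda>w v. 2 * (w \<bullet> v))\<bar>
    \<le> 2 * CARD('n) * Lam * (1 + s) + 2 * s"
proof -
  define X where "X = parabolic_value a b 0 0 (\<lambda>v. 2 * ((fst p - fst P) \<bullet> fst v)) (\<lambda>w v. 2 * (fst w \<bullet> fst v))"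
  have "parabolic_value a b 0 0 (\<lambda>v. 2 * ((p - P) \<bullet> v)) (\<lambda>w v. 2 * (w \<bullet> v)) = X - 2 * (snd p - snd P)"
    by (simp add: X_def parabolic_value_def inner_prod_def)
  moreover have d: "norm (fst p - fst P) \<le> s" "\<bar>snd p - snd P\<bar> \<le> s"
    using dist_fst_le[of p P] dist_snd_le[of p P] s by (auto simp: dist_norm)
  have "2 * CARD('n) * Lam * (1 + norm (fst p - fst P)) \<le> 2 * CARD('n) * Lam * (1 + s)"
    using d(1) Lam by (intro mult_left_mono) auto
  then have "\<bar>X\<bar> \<le> 2 * CARD('n) * Lam * (1 + s)"
    using parabolic_value_distance[OF adm, of "fst p" "fst P"] unfolding X_def by (rule order_trans[rotated])
  then have "\<bar>X - 2 * (snd p - snd P)\<bar> \<le> 2 * CARD('n) * Lam * (1 + s) + 2 * s"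
    using d(2) abs_triangle_ineq4[of X "2 * (snd p - snd P)"] unfolding abs_mult by simp
  ultimately show ?thesis by simp
qed

lemma parabolic_value_spatial_bound:
  fixes D :: "real^'n \<Rightarrow> real" and H :: "real^'n \<Rightarrow> real^'n \<Rightarrow> real" and Lam C :: real
  assumes adm: "admissible_at lam Lam a b c" and D0: "D 0 = 0"
    and D: "\<And>i. \<bar>D (axis i 1)\<bar> \<le> C" and H: "\<And>i j. \<bar>H (axis i 1) (axis j 1)\<bar> \<le> C"
  shows "\<bar>parabolic_value a b 0 0 (\<lambda>v. D (fst v)) (\<lambda>w v. H (fst w) (fst v))\<bar>
    \<le> (CARD('n) * CARD('n) + CARD('n)) * Lam * C"
proof -
  have adm': "\<bar>a i j\<bar> \<le> Lam" "\<bar>b i\<bar> \<le> Lam" for i j using adm by (auto simp: admissible_at_def)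
  have Lam: "0 \<le> Lam" using adm'(2)[of undefined] by linarith
  have "\<bar>\<Sum>i\<in>UNIV. \<Sum>j\<in>UNIV. a i j * H (axis i 1) (axis j 1)\<bar> \<le> (\<Sum>i\<in>(UNIV::'n set). \<Sum>j\<in>(UNIV::'n set). Lam * C)"
    using H adm' Lam by (intro order_trans[OF sum_abs] sum_mono order_trans[OF sum_abs])
      (auto simp: abs_mult intro!: mult_mono)
  moreover have "\<bar>\<Sum>i\<in>UNIV. b i * D (axis i 1)\<bar> \<le> (\<Sum>i\<in>(UNIV::'n set). Lam * C)"
    using D adm' Lam by (intro order_trans[OF sum_abs] sum_mono) (auto simp: abs_mult intro!: mult_mono)
  ultimately show ?thesis
    by (simp add: parabolic_value_def D0 algebra_simps)
qed

text \<open>The barrier \<open>\<eta> (h + M h\<^sup>2 - N |(x, t) - (z, t\<^sub>0)|\<^sup>2)\<close> is compared with \<open>u\<close> in the part of the strip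
  \<open>h < 1/M\<close> within distance \<open>s\<close> of \<open>(z, t\<^sub>0)\<close>. Since the gradient of \<open>h\<close> has length at least 1, the
  term \<open>M h\<^sup>2\<close> contributes at least \<open>2 M \<lambda>\<close> to the operator, while all others are bounded
  independently of \<open>M\<close> because \<open>M h \<le> 1\<close>. The localization is in space and time together, and
  \<open>N = 3 / s\<^sup>2\<close> makes the barrier at most \<open>2 - 3 = -1\<close> (times \<open>\<eta>\<close>) at distance \<open>s\<close>, which is below the
  lower bound for \<open>u\<close> that holds everywhere. Localizing also from above in time avoids any comparison at a
  final time before \<open>T\<close>.\<close>

lemma boundary_barrier:
  fixes \<Omega> :: "(real^'n) set" and z :: "real^'n" and lam Lam T e t0 s C M N \<eta> :: real
  assumes \<Omega>: "open \<Omega>" "bounded \<Omega>" and lam: "0 < lam" and Lam: "0 < Lam"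
    and e: "0 < e" and u: "supersolution \<Omega> T lam Lam e u"
    and h: "C2_jets h Dh Hh"
    and grad: "\<And>x. 1 \<le> norm (\<chi> i. Dh x (axis i 1))"
    and Dh: "\<And>x i. x \<in> cball z s \<Longrightarrow> \<bar>Dh x (axis i 1)\<bar> \<le> C"
    and Hh: "\<And>x i j. x \<in> cball z s \<Longrightarrow> \<bar>Hh x (axis i 1) (axis j 1)\<bar> \<le> C"
    and inside: "\<And>x. x \<in> cball z s \<Longrightarrow> x \<in> \<Omega> \<Longrightarrow> 0 < h x"
    and bdry: "\<And>x. x \<in> cball z s \<Longrightarrow> x \<in> frontier \<Omega> \<Longrightarrow> h x = 0"
    and s: "0 < s" "s < t0" and t0: "t0 \<le> T"
    and M: "1 \<le> M" and N: "N = 3 / s\<^sup>2"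
    and M_large: "1 + 3 * ((CARD('n) * CARD('n) + CARD('n)) * Lam * C) +
       N * (2 * CARD('n) * Lam * (1 + s) + 2 * s) + Lam * (2 + N * s\<^sup>2) \<le> 2 * M * lam"
    and \<eta>: "e < \<eta>" "2 * e * exp ((Lam + 1) * T) \<le> \<eta>"
    and interior: "\<And>x t. x \<in> cball z s \<Longrightarrow> x \<in> \<Omega> \<Longrightarrow> h x = 1 / M \<Longrightarrow> t \<in> {t0 - s..T} \<Longrightarrow> 2 * \<eta> \<le> u (x, t)"
    and x: "x \<in> \<Omega>" "x \<in> cball z s" "h x \<le> 1 / M"
  shows "\<eta> * (h x + M * (h x)\<^sup>2 - N * (dist x z)\<^sup>2) \<le> u (x, t0)"
proof -
  define P where "P = (z, t0)"
  define \<phi> where "\<phi> p = \<eta> * ((h (fst p) + M * (h (fst p))\<^sup>2) + - N * (norm (p - P))\<^sup>2)" for p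
  have d1: "((\<lambda>y::real. y + M * y\<^sup>2) has_real_derivative 1 + 2 * M * y) (at y)" for y
    by (auto intro!: derivative_eq_intros)
  have d2: "((\<lambda>y::real. 1 + 2 * M * y) has_real_derivative 2 * M) (at y)" for y
    by (auto intro!: derivative_eq_intros)
  have c2: "continuous_on UNIV (\<lambda>y::real. 2 * M)" by simp
  define S where "S a p = (\<Sum>i\<in>UNIV. \<Sum>j\<in>UNIV. a i j * Dh (fst p) (fst (axis i 1 :: real^'n, 0::real)) *
      Dh (fst p) (fst (axis j 1 :: real^'n, 0::real)))"
    for a :: "'n \<Rightarrow> 'n \<Rightarrow> real" and p :: "(real^'n) \<times> real"
  define Q where "Q a b p = parabolic_value a b 0 0 (\<lambda>v. Dh (fst p) (fst v)) (\<lambda>w v. Hh (fst p) (fst w) (fst v))"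
    for a b and p :: "(real^'n) \<times> real"
  define G where "G a b p = parabolic_value a b 0 0 (\<lambda>v. 2 * ((p - P) \<bullet> v)) (\<lambda>w v. 2 * (w \<bullet> v))" for a b p
  note J0 = C2_jets_cmult[OF C2_jets_add[OF C2_jets_compose[OF C2_jets_fst[OF h] d1 d2 c2]
      C2_jets_cmult[OF C2_jets_norm_square[of P], of "- N"]], of \<eta>, folded \<phi>_def]
  obtain D H where J: "C2_jets \<phi> D H"
    and val: "\<And>a b (c::real) p. parabolic_value a b c (\<phi> p) (D p) (H p) =
        \<eta> * ((2 * M * S a p + (1 + 2 * M * h (fst p)) * Q a b p + c * (h (fst p) + M * (h (fst p))\<^sup>2)) +
          - N * (G a b p + c * (norm (p - P))\<^sup>2))"
    by (rule that[OF J0]) (unfold \<phi>_def S_def Q_def G_def parabolic_value_add parabolic_value_cmult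
        parabolic_value_compose, subst (2) parabolic_value_split, rule refl)
  have N0: "0 < N" using N s by simp
  have Ns: "N * s\<^sup>2 = 3" using N s by simp
  have \<eta>0: "0 < \<eta>" using e \<eta> by linarith
  have M0: "0 < M" using M by linarith
  have height: "h y + M * (h y)\<^sup>2 \<le> 2" "M * h y \<le> 1" if "0 \<le> h y" "h y \<le> 1 / M" for y
  proof -
    show Mh: "M * h y \<le> 1" using that M0 by (simp add: field_simps)
    have "h y \<le> 1" using that(2) M by (smt (verit) divide_le_eq_1)
    moreover have "M * h y * h y \<le> 1 * 1"
      using Mh \<open>h y \<le> 1\<close> that M0 by (intro mult_mono) auto
    ultimately show "h y + M * (h y)\<^sup>2 \<le> 2" by (simp add: power2_eq_square mult.assoc)
  qed
  have near: "fst p \<in> cball z s" "\<bar>snd p - t0\<bar> \<le> s" if "norm (p - P) \<le> s" for p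
  proof -
    show "fst p \<in> cball z s"
      using dist_fst_le[of P p] that by (simp add: P_def dist_norm norm_minus_commute)
    show "\<bar>snd p - t0\<bar> \<le> s"
      using dist_snd_le[of p P] that by (simp add: P_def dist_norm)
  qed
  have cont_h: "continuous_on UNIV (\<lambda>p::(real^'n) \<times> real. h (fst p))"
    by (intro continuous_on_compose2[OF C2_jets_continuous[OF h]] continuous_intros) auto
  define W where "W = ball P s \<inter> {p. h (fst p) < 1 / M}"
  define K where "K = closure \<Omega> \<times> {0..T} \<inter> (cball P s \<inter> {p. h (fst p) \<le> 1 / M})"
  have "\<phi> (x, t0) \<le> u (x, t0)"
  proof (rule comparison_principle[OF u J])
    show "open W" unfolding W_def by (intro open_Int open_ball open_Collect_less cont_h continuous_intros)
    show "compact K" unfolding K_def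
      by (intro compact_Int_closed compact_cylinder \<Omega> closed_Int closed_cball closed_Collect_le cont_h continuous_intros)
    show "K \<subseteq> closure \<Omega> \<times> {0..T}" by (auto simp: K_def)
    show "W \<inter> (\<Omega> \<times> {0<..T}) \<subseteq> K"
      using closure_subset[of \<Omega>] by (auto simp: K_def W_def)
    have "dist P (x, t0) = dist z x" by (simp add: P_def dist_Pair_Pair)
    then show "(x, t0) \<in> K"
      using x s t0 closure_subset[of \<Omega>] by (auto simp: K_def)
  next
    fix p and a :: "'n \<Rightarrow> 'n \<Rightarrow> real" and b c
    assume p: "p \<in> W \<inter> (\<Omega> \<times> {0<..T})" and adm: "admissible_at lam Lam a b c"
    have ps: "norm (p - P) \<le> s" using p by (simp add: W_def dist_norm norm_minus_commute)
    have h0: "0 \<le> h (fst p)" using inside[OF near(1)[OF ps]] p by force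
    have h1: "h (fst p) \<le> 1 / M" using p by (auto simp: W_def)
    have c: "\<bar>c\<bar> \<le> Lam" using adm by (auto simp: admissible_at_def)
    define B where "B = (CARD('n) * CARD('n) + CARD('n)) * Lam * C"
    have S: "lam \<le> S a p"
    proof -
      have "lam * 1 \<le> lam * (norm (\<chi> i. Dh (fst p) (axis i 1)))\<^sup>2"
        using grad[of "fst p"] lam by (intro mult_left_mono) (auto simp: one_le_power)
      also have "\<dots> \<le> (\<Sum>i\<in>UNIV. \<Sum>j\<in>UNIV. a i j * Dh (fst p) (fst (axis i 1 :: real^'n, 0::real)) *
          Dh (fst p) (fst (axis j 1 :: real^'n, 0::real)))"
        by (rule admissible_at_elliptic[OF adm, where D = "\<lambda>v. Dh (fst p) (fst v)"]) simp
      finally show ?thesis by (simp add: S_def)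
    qed
    have "Dh y 0 = 0" for y
      using linear_0[OF has_derivative_linear[OF C2_jets_has_derivative[OF h]]] .
    then have Q: "\<bar>Q a b p\<bar> \<le> B"
      unfolding Q_def B_def using Dh Hh near(1)[OF ps] by (intro parabolic_value_spatial_bound[OF adm]) auto
    have G: "\<bar>G a b p\<bar> \<le> 2 * CARD('n) * Lam * (1 + s) + 2 * s"
      unfolding G_def by (rule parabolic_value_spacetime_distance[OF adm Lam ps])
    have "M * lam \<le> M * S a p" using S M0 by simp
    moreover have "- (3 * B) \<le> (1 + 2 * M * h (fst p)) * Q a b p"
    proof -
      have "\<bar>(1 + 2 * M * h (fst p)) * Q a b p\<bar> \<le> 3 * B"
        unfolding abs_mult using height(2)[OF h0 h1] h0 M0 Q by (intro mult_mono) auto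
      then show ?thesis by linarith
    qed
    moreover have "- (Lam * 2) \<le> c * (h (fst p) + M * (h (fst p))\<^sup>2)"
    proof -
      have "\<bar>c * (h (fst p) + M * (h (fst p))\<^sup>2)\<bar> \<le> Lam * 2"
        unfolding abs_mult using height(1)[OF h0 h1] h0 M0 c by (intro mult_mono) auto
      then show ?thesis by linarith
    qed
    moreover have "N * (G a b p + c * (norm (p - P))\<^sup>2) \<le> N * ((2 * CARD('n) * Lam * (1 + s) + 2 * s) + Lam * s\<^sup>2)"
    proof (intro mult_left_mono add_mono)
      have "(norm (p - P))\<^sup>2 \<le> s\<^sup>2" using ps by (intro power_mono) auto
      then show "c * (norm (p - P))\<^sup>2 \<le> Lam * s\<^sup>2"
        using c Lam by (intro mult_mono) auto
    qed (use G N0 in auto)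
    ultimately have "1 \<le> (2 * M * S a p + (1 + 2 * M * h (fst p)) * Q a b p + c * (h (fst p) + M * (h (fst p))\<^sup>2)) +
          - N * (G a b p + c * (norm (p - P))\<^sup>2)"
      using M_large unfolding B_def[symmetric] by (simp add: distrib_left mult.left_commute)
    then have "\<eta> * 1 \<le> parabolic_value a b c (\<phi> p) (D p) (H p)"
      unfolding val using \<eta>0 by (intro mult_left_mono) auto
    then show "e < parabolic_value a b c (\<phi> p) (D p) (H p)" using \<eta> by linarith
  next
    fix p assume p: "p \<in> K" "p \<notin> W \<inter> (\<Omega> \<times> {0<..T})"
    have ps: "norm (p - P) \<le> s" using p by (simp add: K_def dist_norm norm_minus_commute)
    have h1: "h (fst p) \<le> 1 / M" using p by (auto simp: K_def)
    have tp: "0 < snd p" "snd p \<in> {t0 - s..T}" using near(2)[OF ps] s p(1) by (auto simp: K_def)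
    have cl: "fst p \<in> closure \<Omega>" using p(1) by (auto simp: K_def)
    have sq: "0 \<le> N * (norm (p - P))\<^sup>2" using N0 by simp
    \<comment> \<open>The three parts of the boundary of the region: \<open>\<partial>\<Omega>\<close>, distance \<open>s\<close> from \<open>P\<close>, and height \<open>1/M\<close>.\<close>
    consider "fst p \<notin> \<Omega>" | "fst p \<in> \<Omega>" "norm (p - P) = s" | "fst p \<in> \<Omega>" "h (fst p) = 1 / M"
      using p ps h1 tp by (cases p) (force simp: W_def dist_norm norm_minus_commute)
    then show "\<phi> p \<le> u p"
    proof cases
      case 1
      then have fr: "fst p \<in> frontier \<Omega>" using closure_minus_open[OF \<Omega>(1) cl] by simp
      then have "h (fst p) = 0" using bdry near(1)[OF ps] by blast
      then have "\<phi> p \<le> 0" using \<eta>0 N0 by (simp add: \<phi>_def)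
      moreover have "0 \<le> u p"
        using u fr tp by (cases p) (auto simp: supersolution_def parabolic_boundary_def)
      ultimately show ?thesis by linarith
    next
      case 2
      have h0: "0 \<le> h (fst p)" using inside[OF near(1)[OF ps]] 2 by force
      have "\<phi> p \<le> \<eta> * (- 1)"
        unfolding \<phi>_def using height(1)[OF h0 h1] Ns 2 \<eta>0 by (intro mult_left_mono) auto
      moreover have "exp ((Lam + 1) * snd p) \<le> exp ((Lam + 1) * T)" using tp Lam by simp
      then have "2 * e * exp ((Lam + 1) * snd p) \<le> 2 * e * exp ((Lam + 1) * T)"
        using e by (intro mult_left_mono) auto
      ultimately show ?thesis
        using supersolution_lower_bound[OF \<Omega> u e Lam cl, of "snd p"] tp \<eta>(2) by simp
    next
      case 3
      have h0: "0 \<le> h (fst p)" using inside[OF near(1)[OF ps]] 3 by force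
      have "\<phi> p \<le> \<eta> * 2"
        unfolding \<phi>_def using height(1)[OF h0 h1] sq \<eta>0 by (intro mult_left_mono) auto
      then show ?thesis using interior[OF near(1)[OF ps] 3 tp(2)] by simp
    qed
  qed
  moreover have "norm ((x, t0) - P) = dist x z" by (simp add: P_def dist_norm norm_Pair)
  ultimately show ?thesis by (simp add: \<phi>_def)
qed

lemma infdist_frontier_le_dist:
  fixes x y :: "'a::euclidean_space"
  assumes "x \<in> \<Omega>" "y \<notin> \<Omega>"
  shows "infdist x (frontier \<Omega>) \<le> dist x y"
proof -
  obtain q where q: "q \<in> closed_segment x y" "q \<in> frontier \<Omega>"
    using connected_Int_frontier[of "closed_segment x y" \<Omega>] assms by auto
  have "infdist x (frontier \<Omega>) \<le> dist x q" using q(2) by (rule infdist_le)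
  also have "\<dots> \<le> dist x y"
    using segment_bound1[OF q(1)] by (simp add: dist_norm norm_minus_commute)
  finally show ?thesis .
qed

text \<open>In a boundary chart let \<open>z = x - h(x) \<nu>\<close> be the projection of \<open>x\<close> to the graph along \<open>\<nu>\<close>. Then
  \<open>|x - z| = h(x)\<close>, and the barrier centred at \<open>(z, t)\<close> is at least \<open>\<eta> h(x)\<close> at \<open>(x, t)\<close> if
  \<open>M \<ge> N\<close>. The constants are chosen in the order \<open>C\<close>, \<open>s\<close>, \<open>N\<close>, \<open>M\<close>, then \<open>\<kappa>\<close> from the interior bound on the
  part of the chart with \<open>h \<ge> 1/M\<close>, then \<open>\<eta>\<close> and \<open>e\<close>.\<close>

lemma boundary_growth:
  fixes \<Omega> :: "(real^'n) set" and lam Lam T T1 r :: real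
  assumes \<Omega>: "open \<Omega>" "bounded \<Omega>" "connected \<Omega>" and C2: "C2_boundary \<Omega>"
    and T1: "0 < T1" and lam: "0 < lam" and Lam: "0 < Lam" and r: "0 < r"
    and p0: "p0 \<in> frontier \<Omega>"
  shows "\<exists>\<delta>>0. \<exists>e>0. \<forall>x\<in>ball p0 \<delta>. x \<in> \<Omega> \<longrightarrow> (\<forall>y u. supersolution \<Omega> T lam Lam e u \<longrightarrow>
    ball y r \<subseteq> \<Omega> \<longrightarrow> (\<forall>w\<in>ball y r. 1 \<le> u (w, 0)) \<longrightarrow>
    (\<forall>t\<in>{T1..T}. e * infdist x (frontier \<Omega>) \<le> u (x, t)))"
proof -
  obtain \<rho> \<nu> g where \<rho>: "0 < \<rho>" and \<nu>: "norm \<nu> = 1" and g: "C2_on UNIV g"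
    and g\<nu>': "\<forall>x s. g (x + s *\<^sub>R \<nu>) = g x"
    and chart: "\<Omega> \<inter> ball p0 \<rho> = {x \<in> ball p0 \<rho>. g x < x \<bullet> \<nu>}"
    using bspec[OF C2[unfolded C2_boundary_def] p0] by (elim exE conjE) (rule that)
  have g\<nu>: "g (x + s *\<^sub>R \<nu>) = g x" for x s using g\<nu>' by blast
  obtain Dg Hg where Jg: "C2_jets g Dg Hg" using C2_on_UNIV_imp_C2_jets[OF g] .
  define h where "h x = x \<bullet> \<nu> + - 1 * g x" for x
  note Jh0 = C2_jets_add[OF C2_jets_linear[OF bounded_linear_inner_left[of \<nu>]] C2_jets_cmult[OF Jg, of "- 1"], folded h_def]
  obtain Dh Hh where Jh: "C2_jets h Dh Hh" by (rule that[OF Jh0])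
  have cont_h: "continuous_on UNIV h" by (rule C2_jets_continuous[OF Jh])
  have shift: "h (x + s *\<^sub>R \<nu>) = h x + s" for x s
    using \<nu> by (simp add: h_def g\<nu> inner_add_left norm_eq_1)
  have in_\<Omega>: "x \<in> \<Omega> \<longleftrightarrow> 0 < h x" if "x \<in> ball p0 \<rho>" for x
  proof -
    have "x \<in> \<Omega> \<inter> ball p0 \<rho> \<longleftrightarrow> g x < x \<bullet> \<nu>" unfolding chart using that by simp
    then show ?thesis using that by (simp add: h_def)
  qed
  \<comment> \<open>A point with \<open>h < 0\<close> has a neighbourhood disjoint from \<open>\<Omega>\<close>.\<close>
  have fr: "h x = 0" if x: "x \<in> ball p0 \<rho>" "x \<in> frontier \<Omega>" for x
  proof (rule antisym)
    have "x \<notin> \<Omega>" using x(2) \<Omega>(1) by (simp add: frontier_def interior_open)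
    then show "h x \<le> 0" using in_\<Omega>[OF x(1)] by simp
    have "open (ball p0 \<rho> \<inter> {x. h x < 0})"
      by (intro open_Int open_ball open_Collect_less cont_h continuous_intros)
    moreover have "ball p0 \<rho> \<inter> {x. h x < 0} \<inter> \<Omega> = {}" using in_\<Omega> by force
    ultimately have "ball p0 \<rho> \<inter> {x. h x < 0} \<inter> closure \<Omega> = {}"
      using open_Int_closure_eq_empty by blast
    moreover have "x \<in> closure \<Omega>" using x(2) by (simp add: frontier_def)
    ultimately show "0 \<le> h x" using x(1) by force
  qed
  \<comment> \<open>The derivative of \<open>h\<close> in the unit direction \<open>\<nu>\<close> is 1, since \<open>g\<close> is constant in that direction.\<close>
  have grad: "1 \<le> norm (\<chi> i. Dh x (axis i 1))" for x
  proof -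
    note D = C2_jets_has_derivative[OF Jh, of x]
    have lin: "linear (Dh x)" using has_derivative_linear[OF D] .
    have "((\<lambda>s. x + s *\<^sub>R \<nu>) has_derivative (\<lambda>s. s *\<^sub>R \<nu>)) (at 0)"
      by (auto intro!: derivative_eq_intros)
    from has_derivative_compose[OF this, of h "Dh x"] D
    have "((\<lambda>s. h (x + s *\<^sub>R \<nu>)) has_derivative (\<lambda>s. Dh x (s *\<^sub>R \<nu>))) (at 0)" by simp
    moreover have "((\<lambda>s. h (x + s *\<^sub>R \<nu>)) has_derivative (\<lambda>s. s)) (at 0)"
      unfolding shift by (auto intro!: derivative_eq_intros)
    ultimately have "(\<lambda>s. Dh x (s *\<^sub>R \<nu>)) = (\<lambda>s. s)" by (rule has_derivative_unique)
    then have "Dh x (1 *\<^sub>R \<nu>) = 1" by (rule fun_cong)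
    moreover have "(\<Sum>i\<in>UNIV. \<nu> $ i *\<^sub>R axis i 1) = \<nu>"
      using basis_expansion[of \<nu>] by (simp only: scalar_mult_eq_scaleR)
    ultimately have "1 = Dh x (\<Sum>i\<in>UNIV. \<nu> $ i *\<^sub>R axis i 1)" by simp
    also have "\<dots> = (\<chi> i. Dh x (axis i 1)) \<bullet> \<nu>"
      by (simp add: linear_sum[OF lin] linear_scale[OF lin] inner_vec_def mult.commute)
    also have "\<dots> \<le> norm (\<chi> i. Dh x (axis i 1)) * norm \<nu>" by (rule norm_cauchy_schwarz)
    finally show ?thesis using \<nu> by simp
  qed
  \<comment> \<open>One function that dominates all first and second derivatives of \<open>h\<close>.\<close>
  define F where "F x = (\<Sum>i\<in>UNIV. \<bar>Dh x (axis i 1)\<bar>) + (\<Sum>i\<in>UNIV. \<Sum>j\<in>UNIV. \<bar>Hh x (axis i 1) (axis j 1)\<bar>)" for x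
  have "continuous_on (cball p0 \<rho>) F"
    unfolding F_def by (intro continuous_intros continuous_on_subset[OF C2_jets_continuous1[OF Jh]]
        continuous_on_subset[OF C2_jets_continuous2[OF Jh]]) auto
  then have "bounded (F ` cball p0 \<rho>)"
    by (intro compact_imp_bounded compact_continuous_image compact_cball)
  then obtain C where C': "\<forall>y\<in>F ` cball p0 \<rho>. norm y \<le> C" unfolding bounded_iff by blast
  have C: "F x \<le> C" if "x \<in> cball p0 \<rho>" for x using bspec[OF C' imageI[OF that]] by simp
  have Dh_le: "\<bar>Dh x (axis i 1)\<bar> \<le> F x" for x i
  proof -
    have "\<bar>Dh x (axis i 1)\<bar> \<le> (\<Sum>i\<in>UNIV. \<bar>Dh x (axis i 1)\<bar>)" by (rule member_le_sum) auto
    moreover have "0 \<le> (\<Sum>i\<in>UNIV. \<Sum>j\<in>UNIV. \<bar>Hh x (axis i 1) (axis j 1)\<bar>)" by (intro sum_nonneg) auto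
    ultimately show ?thesis unfolding F_def by linarith
  qed
  have Hh_le: "\<bar>Hh x (axis i 1) (axis j 1)\<bar> \<le> F x" for x i j
  proof -
    have "\<bar>Hh x (axis i 1) (axis j 1)\<bar> \<le> (\<Sum>j\<in>UNIV. \<bar>Hh x (axis i 1) (axis j 1)\<bar>)" by (rule member_le_sum) auto
    also have "\<dots> \<le> (\<Sum>i\<in>UNIV. \<Sum>j\<in>UNIV. \<bar>Hh x (axis i 1) (axis j 1)\<bar>)"
      by (rule member_le_sum[where f = "\<lambda>i. \<Sum>j\<in>UNIV. \<bar>Hh x (axis i 1) (axis j 1)\<bar>"]) (auto intro: sum_nonneg)
    moreover have "0 \<le> (\<Sum>i\<in>UNIV. \<bar>Dh x (axis i 1)\<bar>)" by (intro sum_nonneg) auto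
    ultimately show ?thesis unfolding F_def by linarith
  qed
  \<comment> \<open>\<open>s \<le> \<rho>/4\<close> keeps the region in the chart, \<open>s \<le> T\<^sub>1/2\<close> keeps it at times when \<open>u\<close> is positive inside.\<close>
  define s where "s = min (\<rho> / 4) (T1 / 2)"
  define N where "N = 3 / s\<^sup>2"
  define M where "M = max (max 1 N) ((1 + 3 * ((CARD('n) * CARD('n) + CARD('n)) * Lam * C) +
       N * (2 * CARD('n) * Lam * (1 + s) + 2 * s) + Lam * (2 + N * s\<^sup>2)) / (2 * lam))"
  have s: "0 < s" "s \<le> \<rho> / 4" "s \<le> T1 / 2" using \<rho> T1 by (auto simp: s_def)
  have M: "1 \<le> M" "N \<le> M" "1 + 3 * ((CARD('n) * CARD('n) + CARD('n)) * Lam * C) +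
       N * (2 * CARD('n) * Lam * (1 + s) + 2 * s) + Lam * (2 + N * s\<^sup>2) \<le> 2 * M * lam"
  proof -
    have "(1 + 3 * ((CARD('n) * CARD('n) + CARD('n)) * Lam * C) +
       N * (2 * CARD('n) * Lam * (1 + s) + 2 * s) + Lam * (2 + N * s\<^sup>2)) / (2 * lam) \<le> M"
      unfolding M_def by simp
    then show "1 + 3 * ((CARD('n) * CARD('n) + CARD('n)) * Lam * C) +
       N * (2 * CARD('n) * Lam * (1 + s) + 2 * s) + Lam * (2 + N * s\<^sup>2) \<le> 2 * M * lam"
      using lam by (simp add: pos_divide_le_eq mult_ac)
  qed (simp_all add: M_def)
  define Z where "Z = cball p0 (3 * \<rho> / 4) \<inter> {x. 1 / M \<le> h x}"
  have Z_compact: "compact Z" unfolding Z_def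
    by (intro compact_Int_closed compact_cball closed_Collect_le cont_h continuous_intros)
  have Z_sub: "Z \<subseteq> \<Omega>"
  proof
    fix x assume x: "x \<in> Z"
    have "0 < 1 / M" using M(1) by simp
    also have "\<dots> \<le> h x" using x by (simp add: Z_def)
    finally have "0 < h x" .
    moreover have "x \<in> ball p0 \<rho>" using x \<rho> by (simp add: Z_def)
    ultimately show "x \<in> \<Omega>" using in_\<Omega> by blast
  qed
  have half: "0 < T1 / 2" using T1 by simp
  obtain \<kappa> where \<kappa>: "0 < \<kappa>" and interior: "\<forall>x\<in>Z. \<forall>y u. supersolution \<Omega> T lam Lam \<kappa> u \<longrightarrow>
      ball y r \<subseteq> \<Omega> \<longrightarrow> (\<forall>w\<in>ball y r. 1 \<le> u (w, 0)) \<longrightarrow> (\<forall>t\<in>{T1 / 2..T}. \<kappa> \<le> u (x, t))"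
    using interior_positivity[OF \<Omega> lam Lam r Z_compact Z_sub half, where T = T] by (elim exE conjE) (rule that)
  define \<eta> where "\<eta> = \<kappa> / 2"
  define e where "e = min \<kappa> (\<eta> / (2 + 2 * exp ((Lam + 1) * T)))"
  have \<eta>: "0 < \<eta>" using \<kappa> by (simp add: \<eta>_def)
  define E where "E = exp ((Lam + 1) * T)"
  have E: "0 < E" by (simp add: E_def)
  have e: "0 < e" using \<kappa> \<eta> by (simp add: e_def E_def[symmetric] E add_pos_pos)
  have "e \<le> \<eta> / (2 + 2 * E)" by (simp add: e_def E_def)
  then have "e * (2 + 2 * E) \<le> \<eta>" using E by (simp add: pos_le_divide_eq)
  then have e2: "2 * e + 2 * e * E \<le> \<eta>" by (simp add: algebra_simps)
  have "0 < 2 * e * E" using e E by simp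
  then have e\<eta>: "e < \<eta>" "2 * e * exp ((Lam + 1) * T) \<le> \<eta>"
    using e2 e unfolding E_def[symmetric] by linarith+
  have p0_ball: "p0 \<in> ball p0 \<rho>" using \<rho> by simp
  have "isCont h p0" using cont_h by (simp add: continuous_on_eq_continuous_at)
  moreover have "0 < min s (1 / M)" using s M by simp
  ultimately obtain \<delta>1 where \<delta>1: "0 < \<delta>1" "\<And>x. dist x p0 < \<delta>1 \<Longrightarrow> dist (h x) (h p0) < min s (1 / M)"
    unfolding continuous_at_eps_delta by blast
  \<comment> \<open>Close enough to \<open>p0\<close> for \<open>h\<close> to be below \<open>s\<close> and \<open>1/M\<close> and for \<open>z\<close> to stay within \<open>\<rho>/2\<close> of \<open>p0\<close>.\<close>
  define \<delta> where "\<delta> = min \<delta>1 (\<rho> / 4)"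
  have \<delta>: "0 < \<delta>" using \<delta>1 \<rho> by (simp add: \<delta>_def)
  have main: "e * infdist x (frontier \<Omega>) \<le> u (x, t)"
    if x: "x \<in> ball p0 \<delta>" "x \<in> \<Omega>" and u: "supersolution \<Omega> T lam Lam e u"
      and y: "ball y r \<subseteq> \<Omega>" and init: "\<forall>w\<in>ball y r. 1 \<le> u (w, 0)" and t: "t \<in> {T1..T}" for x y u t
  proof -
    have x_ball: "x \<in> ball p0 \<rho>" using x(1) \<rho> by (auto simp: \<delta>_def)
    have h0: "0 < h x" using in_\<Omega>[OF x_ball] x(2) by simp
    have "dist (h x) (h p0) < min s (1 / M)" using x(1) by (intro \<delta>1(2)) (auto simp: \<delta>_def dist_commute)
    then have hx: "h x < s" "h x < 1 / M" using fr[OF p0_ball p0] h0 by (auto simp: dist_real_def)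
    define z where "z = x - h x *\<^sub>R \<nu>"
    have hz: "h z = 0" using shift[of x "- h x"] by (simp add: z_def)
    have dxz: "dist x z = h x" using \<nu> h0 by (simp add: z_def dist_norm)
    have cball: "cball z s \<subseteq> cball p0 (3 * \<rho> / 4)"
    proof
      fix w assume w: "w \<in> cball z s"
      have "dist p0 x < \<rho> / 4" using x(1) by (simp add: \<delta>_def)
      then show "w \<in> cball p0 (3 * \<rho> / 4)"
        using w dxz hx(1) s(2) dist_triangle[of p0 w z] dist_triangle[of p0 z x] by simp
    qed
    have cball1: "w \<in> ball p0 \<rho>" "w \<in> cball p0 \<rho>" if "w \<in> cball z s" for w
      using subsetD[OF cball that] \<rho> by auto
    have u\<kappa>: "supersolution \<Omega> T lam Lam \<kappa> u" by (rule supersolution_mono[OF u]) (simp add: e_def)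
    have "\<eta> * (h x + M * (h x)\<^sup>2 - N * (dist x z)\<^sup>2) \<le> u (x, t)"
    proof (rule boundary_barrier[OF \<Omega>(1,2) lam Lam e u Jh grad _ _ _ _ s(1) _ _ M(1) N_def M(3) e\<eta>])
      show "\<bar>Dh w (axis i 1)\<bar> \<le> C" if "w \<in> cball z s" for w i
        using Dh_le C cball1(2)[OF that] order_trans by blast
      show "\<bar>Hh w (axis i 1) (axis j 1)\<bar> \<le> C" if "w \<in> cball z s" for w i j
        using Hh_le C cball1(2)[OF that] order_trans by blast
      show "0 < h w" if "w \<in> cball z s" "w \<in> \<Omega>" for w
        using in_\<Omega>[OF cball1(1)[OF that(1)]] that(2) by simp
      show "h w = 0" if "w \<in> cball z s" "w \<in> frontier \<Omega>" for w
        using fr cball1(1) that by blast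
      show "2 * \<eta> \<le> u (w, t')" if "w \<in> cball z s" "w \<in> \<Omega>" "h w = 1 / M" "t' \<in> {t - s..T}" for w t'
      proof -
        have "w \<in> Z" using subsetD[OF cball that(1)] that(3) by (simp add: Z_def)
        moreover have "t' \<in> {T1 / 2..T}" using that(4) t s by auto
        ultimately show ?thesis using interior u\<kappa> y init by (simp add: \<eta>_def)
      qed
      show "s < t" using s t T1 by simp
      show "t \<le> T" using t by simp
      show "x \<in> cball z s" using dxz hx by (simp add: dist_commute)
    qed (use x hx in auto)
    moreover have "N * (h x)\<^sup>2 \<le> M * (h x)\<^sup>2" using M(2) by (intro mult_right_mono) auto
    then have "\<eta> * h x \<le> \<eta> * (h x + M * (h x)\<^sup>2 - N * (dist x z)\<^sup>2)"
      using \<eta> dxz by (intro mult_left_mono) auto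
    moreover have "z \<notin> \<Omega>" using in_\<Omega>[OF cball1(1), of z] hz s(1) by simp
    then have "infdist x (frontier \<Omega>) \<le> h x" using infdist_frontier_le_dist[OF x(2)] dxz by metis
    then have "e * infdist x (frontier \<Omega>) \<le> \<eta> * h x"
      using e\<eta>(1) \<eta> by (intro mult_mono) (auto simp: infdist_nonneg)
    ultimately show ?thesis by linarith
  qed
  then show ?thesis using \<delta> e by blast
qed

section \<open>The lower bound on the whole domain\<close>

theorem theorem5p2:
  fixes \<Omega> :: "(real^'n) set" and T1 T lam Lam r :: real
  assumes "open \<Omega>" and "bounded \<Omega>" and "connected \<Omega>" and "C2_boundary \<Omega>"
    and "0 < T1" and "T1 < T" and "lam > 0" and "Lam > 0" and "r > 0"
  shows "\<exists>\<epsilon>>0. \<exists>\<mu>>0. \<forall>y a b c u.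
    ball y r \<subseteq> \<Omega> \<longrightarrow>
    coeff_conds \<Omega> T lam Lam a b c \<longrightarrow>
    lsc_on (closure \<Omega> \<times> {0..T}) u \<longrightarrow>
    viscosity_le \<Omega> T a b c u \<epsilon> \<longrightarrow>
    (\<forall>x \<in> ball y r. u (x, 0) \<ge> 1) \<longrightarrow>
    (\<forall>p \<in> parabolic_boundary \<Omega> T. u p \<ge> 0) \<longrightarrow>
    (\<forall>x \<in> \<Omega>. \<forall>t \<in> {T1..T}. u (x, t) \<ge> \<mu> * infdist x (frontier \<Omega>))"
proof -
  define R where "R e x \<longleftrightarrow> x \<in> \<Omega> \<longrightarrow> (\<forall>y u. supersolution \<Omega> T lam Lam e u \<longrightarrow>
    ball y r \<subseteq> \<Omega> \<longrightarrow> (\<forall>w\<in>ball y r. 1 \<le> u (w, 0)) \<longrightarrow>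
    (\<forall>t\<in>{T1..T}. e * infdist x (frontier \<Omega>) \<le> u (x, t)))" for e x
  have R_mono: "R e' x" if R: "R e x" and e': "e' \<le> e" for e e' x
    unfolding R_def
  proof (intro allI impI ballI)
    fix y u t
    assume "x \<in> \<Omega>" and u: "supersolution \<Omega> T lam Lam e' u" and "ball y r \<subseteq> \<Omega>"
      "\<forall>w\<in>ball y r. 1 \<le> u (w, 0)" "t \<in> {T1..T}"
    then have "e * infdist x (frontier \<Omega>) \<le> u (x, t)"
      using R supersolution_mono[OF u e'] unfolding R_def by blast
    moreover have "e' * infdist x (frontier \<Omega>) \<le> e * infdist x (frontier \<Omega>)"
      using e' by (intro mult_right_mono infdist_nonneg)
    ultimately show "e' * infdist x (frontier \<Omega>) \<le> u (x, t)" by linarith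
  qed
  have "\<exists>e>0. \<forall>x\<in>closure \<Omega>. R e x"
  proof (rule compact_uniform_constant[OF _ _ R_mono])
    show "compact (closure \<Omega>)" using assms(2) by (simp add: compact_closure)
  next
    fix x assume "x \<in> closure \<Omega>"
    then consider "x \<in> frontier \<Omega>" | "x \<in> \<Omega>" using closure_minus_open[OF assms(1)] by blast
    then show "\<exists>\<delta>>0. \<exists>e>0. \<forall>x'\<in>ball x \<delta>. R e x'"
    proof cases
      case 1
      show ?thesis
        unfolding R_def by (rule boundary_growth[OF assms(1-5) assms(7-9) 1])
    next
      case 2
      then obtain \<delta> where \<delta>: "0 < \<delta>" "cball x \<delta> \<subseteq> \<Omega>" using assms(1) open_contains_cball by blast
      obtain \<kappa> where \<kappa>: "0 < \<kappa>" and interior: "\<forall>x'\<in>cball x \<delta>. \<forall>y u. supersolution \<Omega> T lam Lam \<kappa> u \<longrightarrow>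
          ball y r \<subseteq> \<Omega> \<longrightarrow> (\<forall>w\<in>ball y r. 1 \<le> u (w, 0)) \<longrightarrow> (\<forall>t\<in>{T1..T}. \<kappa> \<le> u (x', t))"
        using interior_positivity[OF assms(1-3) assms(7-9) compact_cball \<delta>(2) assms(5), where T = T]
        by (elim exE conjE) (rule that)
      obtain D where D: "0 < D" "\<And>x'. x' \<in> cball x \<delta> \<Longrightarrow> infdist x' (frontier \<Omega>) \<le> D"
      proof -
        have "bounded ((\<lambda>x'. infdist x' (frontier \<Omega>)) ` cball x \<delta>)"
          by (intro compact_imp_bounded compact_continuous_image compact_cball continuous_intros)
        then obtain B where B: "0 < B" "\<forall>d\<in>(\<lambda>x'. infdist x' (frontier \<Omega>)) ` cball x \<delta>. norm d \<le> B"
          unfolding bounded_pos by blast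
        have "infdist x' (frontier \<Omega>) \<le> B" if "x' \<in> cball x \<delta>" for x'
          using bspec[OF B(2) imageI[OF that]] by simp
        then show ?thesis by (rule that[OF B(1)])
      qed
      \<comment> \<open>\<open>D\<close> bounds the distance to the boundary, so a constant lower bound dominates \<open>e\<close> times that distance.\<close>
      define e where "e = min \<kappa> (\<kappa> / D)"
      have e: "0 < e" "e \<le> \<kappa>" "e * D \<le> \<kappa>"
        using \<kappa> D(1) by (auto simp: e_def min_def field_simps)
      have "R e x'" if x': "x' \<in> ball x \<delta>" for x'
        unfolding R_def
      proof (intro allI impI ballI)
        fix y u t
        assume u: "supersolution \<Omega> T lam Lam e u" and y: "ball y r \<subseteq> \<Omega>"
          "\<forall>w\<in>ball y r. 1 \<le> u (w, 0)" and t: "t \<in> {T1..T}"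
        have x'': "x' \<in> cball x \<delta>" using x' by simp
        have "e * infdist x' (frontier \<Omega>) \<le> e * D" using D(2)[OF x''] e by (intro mult_left_mono) auto
        also have "\<dots> \<le> \<kappa>" by (rule e)
        also have "\<kappa> \<le> u (x', t)"
          using interior x'' supersolution_mono[OF u e(2)] y t by blast
        finally show "e * infdist x' (frontier \<Omega>) \<le> u (x', t)" .
      qed
      then show ?thesis using \<delta>(1) e(1) by blast
    qed
  qed
  then obtain e where e: "0 < e" "\<And>x. x \<in> \<Omega> \<Longrightarrow> R e x" using closure_subset by blast
  show ?thesis
  proof (rule exI[of _ e], rule conjI[OF e(1)], rule exI[of _ e], rule conjI[OF e(1)], intro allI impI ballI)
    fix y a b c u x t
    assume "ball y r \<subseteq> \<Omega>" and "coeff_conds \<Omega> T lam Lam a b c" "lsc_on (closure \<Omega> \<times> {0..T}) u"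
      "viscosity_le \<Omega> T a b c u e" and init: "\<forall>x \<in> ball y r. u (x, 0) \<ge> 1"
      and "\<forall>p \<in> parabolic_boundary \<Omega> T. u p \<ge> 0" and x: "x \<in> \<Omega>" "t \<in> {T1..T}"
    moreover from this have "supersolution \<Omega> T lam Lam e u" unfolding supersolution_def by blast
    ultimately show "u (x, t) \<ge> e * infdist x (frontier \<Omega>)" using e(2)[OF x(1)] unfolding R_def by blast
  qed
qed

end
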